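(* Let $\Pi$ be an irreducible generic unramified representation of $\mathrm{PGL}_4(F)$ with $\Pi\simeq I_{\mathrm{GL}_4}(\chi)$, $\chi=(\chi_1,\chi_2,\chi_2^{-1},\chi_1^{-1})$ unramified, admitting a nonzero Shalika functional; put $t_i=\chi_i(\varpi)$ and $g_\chi=\mathrm{diag}(t_1,t_2,t_2^{-1},t_1^{-1})\in\mathrm{Sp}_4(\mathbf C)$, and let $\sigma$ be the unramified representation of $\mathrm{PGSp}_4(F)$ with Satake parameter $g_\chi$. Let $\phi_0$ be a spherical vector, $\Lambda$ the Shalika functional normalized as in the context, $\mathcal S_\Pi(g)=\Lambda(\Pi(g)\phi_0)$. Then $$J(\phi_0,f_s,s):=\int_{\mathrm{GL}_2(F)N_{\mathbf H}(F)\backslash\mathbf H(F)}f_s(h)\,\mathcal S_\Pi(\iota(h))\,dh=L(s,\sigma,\mathrm{std}),$$ where $L(s,\sigma,\mathrm{std})=\prod_{\lambda\in\{t_1t_2,\,t_1t_2^{-1},\,1,\,t_1^{-1}t_2,\,t_1^{-1}t_2^{-1}\}}(1-\lambda q^{-s})^{-1}$.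
   Context: $F$ non-archimedean local field of characteristic zero, uniformizer $\varpi$, residue field size $q$, $\zeta_F(s)=(1-q^{-s})^{-1}$; $\psi$ a fixed nontrivial additive character. $I_{\mathrm{GL}_4}(\chi)$ is normalized induction from the upper triangular Borel. A Shalika functional on a representation $\Pi$ of $\mathrm{PGL}_4(F)$ is a nonzero linear form with $\Lambda(\Pi(\left(\begin{smallmatrix}g&0\\0&g\end{smallmatrix}\right)\left(\begin{smallmatrix}I&X\\0&I\end{smallmatrix}\right))v)=\psi(\mathrm{Tr}X)\Lambda(v)$ for $g\in\mathrm{GL}_2(F)$, $X\in M_2(F)$. $\mathbf H(F)=\mathrm{GSp}_4(F)=\{g\in\mathrm{GL}_4(F):g^tJg=m_gJ\}$ with $J=\left(\begin{smallmatrix}0&J_2\\-J_2&0\end{smallmatrix}\right)$, $J_2=\left(\begin{smallmatrix}0&1\\1&0\end{smallmatrix}\right)$; $\iota:\mathbf H(F)\to\mathrm{PGL}_4(F)$, $h\mapsto w h w^{-1}$ mod center, $w=\mathrm{diag}(1,1,-1,1)$. $P_{\mathbf H}=M_{\mathbf H}N_{\mathbf H}$ Siegel parabolic, $N_{\mathbf H}=\{\left(\begin{smallmatrix}1&0&a&x\\0&1&y&a\\0&0&1&0\\0&0&0&1\end{smallmatrix}\right)\}$, $\mathrm{GL}_2(F)\hookrightarrow\mathbf H(F)$ by $h\mapsto\left(\begin{smallmatrix}h&0\\0&\det(h)J_2{}^th^{-1}J_2\end{smallmatrix}\right)$, $\delta_{P_{\mathbf H}}\left(\left(\begin{smallmatrix}g&*\\0&\mu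 J_2{}^tg^{-1}J_2\end{smallmatrix}\right)\right)=|\det g/\mu|^3$. $f_s\in\mathrm{Ind}_{P_{\mathbf H}(F)}^{\mathbf H(F)}(\delta_{P_{\mathbf H}}^{(s+1)/3})$ (non-normalized) with $f_s(k)=\zeta_F(s+1)\zeta_F(2s)$ for $k\in\mathbf H(\mathcal O)$. Notation: $e^{a\check\alpha_1+b\check\alpha_2}(g_\chi)=t_1^at_2^b$, $\check\rho=2\check\alpha_1+\check\alpha_2$, $\mathcal A(f)=\sum_\omega\det(\omega)\,\omega(f)$ over the 8 signed permutations $\omega$ acting on exponents $(a,b)$. Normalization: $\Lambda$ is such that for all $n\ge0$, $\mathcal S_\Pi(\mathrm{diag}(\varpi^nI_2,I_2))=\frac{q^{-2n}}{1+q^{-1}}\mathcal A\big(e^{\check\rho+n(\check\alpha_1+\check\alpha_2)}(1-q^{-1}e^{-(\check\alpha_1+\check\alpha_2)})(1-q^{-1}e^{-(\check\alpha_1-\check\alpha_2)})\big)(g_\chi)/\mathcal A(e^{\check\rho})(g_\chi)$. Measure: $\int_{\mathrm{GL}_2N_{\mathbf H}\backslash\mathbf H}\Phi(h)dh=\int_{F^\times}\int_{\mathbf H(\mathcal O)}\delta_{P_{\mathbf H}}^{-1}(m(\mu))\Phi(m(\mu)k)dk\,d^\times\mu$, $m(\mu)=\mathrm{diag}(I_2,\mu I_2)$, $\mathrm{vol}(\mathbf H(\mathcal O))=\mathrm{vol}(\mathcal O^\times)=1$.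
   Formalization: ψ is assumed to have conductor O (otherwise the normalization of Λ is impossible or J is not L; e.g. t1=i, t2=exp(-iπ/4), conductor exponent -4 gives J=-q^{4s}L), and s is taken where the integral converges absolutely, |λ|<q^{Re s} for all five λ. *)

theory Defs
  imports "HOL-Analysis.Analysis" "HOL-Library.Poly_Mapping" "HOL-Library.Product_Plus"
begin

section \<open>Non-archimedean local fields of characteristic zero\<close>

text \<open>
  Here \<open>absv\<close> is the absolute value of the field, normalized so that a uniformizer has
  absolute value 1/q, with q the number of residue classes \<open>x + \<pp>\<close> of integers x.  The metric is
  the one it induces, so that the fields and their matrix spaces carry their usual topology and
  Borel sets.
\<close>

class nonarch_local_field = field_char_0 + complete_space +
  fixes absv :: "'a \<Rightarrow> real"
  assumes dist_absv: "dist x y = absv (x - y)"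
    and absv_times: "absv (x * y) = absv x * absv y"
    and absv_ultrametric: "absv (x + y) \<le> max (absv x) (absv y)"
    and finite_residue_field: "finite ((\<lambda>x. {y. absv (y - x) < 1}) ` {x. absv x \<le> 1})"
    and ex_uniformizer:
      "\<exists>p. absv p < 1 \<and> (\<forall>x. absv x < 1 \<longrightarrow> absv x \<le> absv p) \<and>
           absv p = 1 / real (card ((\<lambda>x. {y. absv (y - x) < 1}) ` {x. absv x \<le> 1}))"

definition residue_size :: "'a::nonarch_local_field itself \<Rightarrow> nat" where
  "residue_size T = card ((\<lambda>x::'a. {y. absv (y - x) < 1}) ` {x. absv x \<le> 1})"

definition uniformizer :: "'a::nonarch_local_field \<Rightarrow> bool" where
  "uniformizer p \<longleftrightarrow> absv p < 1 \<and> (\<forall>x::'a. absv x < 1 \<longrightarrow> absv x \<le> absv p)"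

definition zeta_F :: "'a::nonarch_local_field itself \<Rightarrow> complex \<Rightarrow> complex" where
  "zeta_F T s = inverse (1 - of_nat (residue_size T) powr (- s))"

definition additive_character :: "('a::nonarch_local_field \<Rightarrow> complex) \<Rightarrow> bool" where
  "additive_character \<psi> \<longleftrightarrow> continuous_on UNIV \<psi> \<and> (\<forall>x. cmod (\<psi> x) = 1) \<and>
     (\<forall>x y. \<psi> (x + y) = \<psi> x * \<psi> y)"

text \<open>The conductor is the ring of integers: the largest fractional ideal on which \<open>\<psi>\<close> is trivial.\<close>

definition conductor_integers :: "('a::nonarch_local_field \<Rightarrow> complex) \<Rightarrow> bool" where
  "conductor_integers \<psi> \<longleftrightarrow> {x. \<forall>y. absv y \<le> 1 \<longrightarrow> \<psi> (x * y) = 1} = {x. absv x \<le> 1}"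

text \<open>Values of multiplicative characters at 0 are irrelevant; continuity follows from
  triviality on the units.\<close>

definition unramified_character :: "('a::nonarch_local_field \<Rightarrow> complex) \<Rightarrow> bool" where
  "unramified_character chi \<longleftrightarrow> (\<forall>x. x \<noteq> 0 \<longrightarrow> chi x \<noteq> 0) \<and>
     (\<forall>x y. x \<noteq> 0 \<longrightarrow> y \<noteq> 0 \<longrightarrow> chi (x * y) = chi x * chi y) \<and> (\<forall>u. absv u = 1 \<longrightarrow> chi u = 1)"


section \<open>Matrix groups\<close>

text \<open>
  Matrix entries are addressed by the numerals 1 to 4 of the index type 4.  In the order of that
  type 4 = 0 is the least element, so triangularity is spelled out entry by entry.
\<close>

definition block :: "'a::zero^2^2 \<Rightarrow> 'a^2^2 \<Rightarrow> 'a^2^2 \<Rightarrow> 'a^2^2 \<Rightarrow> 'a^4^4" where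
  "block A B C D = vector
     [vector [A$1$1, A$1$2, B$1$1, B$1$2],
      vector [A$2$1, A$2$2, B$2$1, B$2$2],
      vector [C$1$1, C$1$2, D$1$1, D$1$2],
      vector [C$2$1, C$2$2, D$2$1, D$2$2]]"

definition upper_left :: "'a^4^4 \<Rightarrow> 'a::zero^2^2" where
  "upper_left g = vector [vector [g$1$1, g$1$2], vector [g$2$1, g$2$2]]"

definition diag4 :: "'a \<Rightarrow> 'a \<Rightarrow> 'a \<Rightarrow> 'a \<Rightarrow> 'a::zero^4^4" where
  "diag4 a b c d = vector [vector [a,0,0,0], vector [0,b,0,0], vector [0,0,c,0], vector [0,0,0,d]]"

definition upper_triangular :: "'a::zero^4^4 \<Rightarrow> bool" where
  "upper_triangular b \<longleftrightarrow>
     b$2$1 = 0 \<and> b$3$1 = 0 \<and> b$4$1 = 0 \<and> b$3$2 = 0 \<and> b$4$2 = 0 \<and> b$4$3 = 0"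

definition J2 :: "'a::field^2^2" where
  "J2 = vector [vector [0, 1], vector [1, 0]]"

definition J4 :: "'a::field^4^4" where
  "J4 = block 0 J2 (- J2) 0"

definition GL4 :: "('a::field^4^4) set" where
  "GL4 = {g. invertible g}"

definition GSp4 :: "('a::field^4^4) set" where
  "GSp4 = {g. invertible g \<and> (\<exists>m. m \<noteq> 0 \<and> transpose g ** J4 ** g = mat m ** J4)}"

definition multiplier :: "'a::field^4^4 \<Rightarrow> 'a" where
  "multiplier g = (THE m. transpose g ** J4 ** g = mat m ** J4)"

definition GL4_integral :: "('a::nonarch_local_field^4^4) set" where
  "GL4_integral = {g. (\<forall>i j. absv (g$i$j) \<le> 1) \<and> absv (det g) = 1}"

definition GSp4_integral :: "('a::nonarch_local_field^4^4) set" where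
  "GSp4_integral = GSp4 \<inter> GL4_integral"

text \<open>A representative in the general linear group of the image of \<open>h\<close> in the projective group.\<close>

definition iota :: "'a::field^4^4 \<Rightarrow> 'a^4^4" where
  "iota h = diag4 1 1 (-1) 1 ** h ** matrix_inv (diag4 1 1 (-1) 1)"

definition siegel_element :: "'a::field^2^2 \<Rightarrow> 'a^2^2 \<Rightarrow> 'a \<Rightarrow> 'a^4^4" where
  "siegel_element g B \<mu> = block g B 0 (mat \<mu> ** J2 ** transpose (matrix_inv g) ** J2)"

definition siegel_parabolic :: "('a::field^4^4) set" where
  "siegel_parabolic = GSp4 \<inter> {siegel_element g B \<mu> |g B \<mu>. invertible g \<and> \<mu> \<noteq> 0}"

text \<open>The parameter \<open>\<mu>\<close> of an element of the Siegel parabolic is its multiplier; see the lemma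
  \<open>siegel_delta_siegel_element\<close> below.\<close>

definition siegel_delta :: "'a::nonarch_local_field^4^4 \<Rightarrow> real" where
  "siegel_delta p = absv (det (upper_left p) / multiplier p) ^ 3"

definition siegel_m :: "'a::field \<Rightarrow> 'a^4^4" where
  "siegel_m \<mu> = block (mat 1) 0 0 (mat \<mu>)"


section \<open>Smooth representations\<close>

text \<open>
  A representation of a group \<open>G\<close> of matrices on a complex vector space (with scalar
  multiplication \<open>sm\<close>) is a function on all matrices of which only the values on \<open>G\<close> matter.
  Representations of a group modulo its centre are those on which the scalar matrices act trivially.
\<close>

definition smooth_rep ::
  "('a::nonarch_local_field^4^4) set \<Rightarrow> (complex \<Rightarrow> 'v::ab_group_add \<Rightarrow> 'v) \<Rightarrow> ('a^4^4 \<Rightarrow> 'v \<Rightarrow> 'v) \<Rightarrow> bool"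
  where
  "smooth_rep G sm \<pi> \<longleftrightarrow> vector_space sm \<and>
     (\<forall>g\<in>G. Vector_Spaces.linear sm sm (\<pi> g)) \<and>
     \<pi> (mat 1) = id \<and> (\<forall>g\<in>G. \<forall>h\<in>G. \<pi> (g ** h) = \<pi> g \<circ> \<pi> h) \<and>
     (\<forall>v. \<exists>U. open U \<and> mat 1 \<in> U \<and> (\<forall>u\<in>U \<inter> G. \<pi> u v = v))"

definition trivial_centre :: "('a::field^4^4 \<Rightarrow> 'v \<Rightarrow> 'v) \<Rightarrow> bool" where
  "trivial_centre \<pi> \<longleftrightarrow> (\<forall>c. c \<noteq> 0 \<longrightarrow> \<pi> (mat c) = id)"

definition irreducible_rep ::
  "('a^4^4) set \<Rightarrow> (complex \<Rightarrow> 'v::ab_group_add \<Rightarrow> 'v) \<Rightarrow> ('a^4^4 \<Rightarrow> 'v \<Rightarrow> 'v) \<Rightarrow> bool" where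
  "irreducible_rep G sm \<pi> \<longleftrightarrow> (\<exists>v::'v. v \<noteq> 0) \<and>
     (\<forall>W. module.subspace sm W \<and> (\<forall>g\<in>G. \<pi> g ` W \<subseteq> W) \<longrightarrow> W = {0} \<or> W = UNIV)"

definition spherical_vector :: "('a^4^4) set \<Rightarrow> ('a^4^4 \<Rightarrow> 'v::zero \<Rightarrow> 'v) \<Rightarrow> 'v \<Rightarrow> bool" where
  "spherical_vector K \<pi> v \<longleftrightarrow> v \<noteq> 0 \<and> (\<forall>k\<in>K. \<pi> k v = v)"

text \<open>Existence of a nonzero Whittaker functional.\<close>

definition generic_rep ::
  "('a::nonarch_local_field \<Rightarrow> complex) \<Rightarrow> (complex \<Rightarrow> 'v::ab_group_add \<Rightarrow> 'v) \<Rightarrow> ('a^4^4 \<Rightarrow> 'v \<Rightarrow> 'v) \<Rightarrow> bool"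
  where
  "generic_rep \<psi> sm \<pi> \<longleftrightarrow> (\<exists>l. Vector_Spaces.linear sm (*) l \<and> (\<exists>v. l v \<noteq> 0) \<and>
     (\<forall>u v. upper_triangular u \<and> (\<forall>i. u$i$i = 1) \<longrightarrow>
        l (\<pi> u v) = \<psi> (u$1$2 + u$2$3 + u$3$4) * l v))"

definition shalika_functional ::
  "('a::nonarch_local_field \<Rightarrow> complex) \<Rightarrow> (complex \<Rightarrow> 'v::ab_group_add \<Rightarrow> 'v) \<Rightarrow> ('a^4^4 \<Rightarrow> 'v \<Rightarrow> 'v)
     \<Rightarrow> ('v \<Rightarrow> complex) \<Rightarrow> bool" where
  "shalika_functional \<psi> sm \<pi> \<Lambda> \<longleftrightarrow> Vector_Spaces.linear sm (*) \<Lambda> \<and> (\<exists>v. \<Lambda> v \<noteq> 0) \<and>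
     (\<forall>g X v. invertible g \<longrightarrow>
        \<Lambda> (\<pi> (block g 0 0 g ** block (mat 1) X 0 (mat 1)) v) = \<psi> (trace X) * \<Lambda> v)"


subsection \<open>Induced representations\<close>

text \<open>
  The space of the non-normalized induction to \<open>G\<close> of the character \<open>c\<close> of the subgroup \<open>B\<close>; the
  group acts on it by right translation.  Functions are extended by 0 outside \<open>G\<close>.
\<close>

definition induced ::
  "('a::nonarch_local_field^4^4) set \<Rightarrow> ('a^4^4) set \<Rightarrow> ('a^4^4 \<Rightarrow> complex) \<Rightarrow> ('a^4^4 \<Rightarrow> complex) set" where
  "induced G B c = {f. (\<forall>x. x \<notin> G \<longrightarrow> f x = 0) \<and> (\<forall>b\<in>B. \<forall>g\<in>G. f (b ** g) = c b * f g) \<and>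
     (\<exists>U. open U \<and> mat 1 \<in> U \<and> (\<forall>u\<in>U \<inter> G. \<forall>g\<in>G. f (g ** u) = f g))}"

definition isomorphic_to_induced ::
  "('a::nonarch_local_field^4^4) set \<Rightarrow> (complex \<Rightarrow> 'v::ab_group_add \<Rightarrow> 'v) \<Rightarrow> ('a^4^4 \<Rightarrow> 'v \<Rightarrow> 'v)
     \<Rightarrow> ('a^4^4 \<Rightarrow> complex) set \<Rightarrow> bool" where
  "isomorphic_to_induced G sm \<pi> S \<longleftrightarrow> (\<exists>T. bij_betw T UNIV S \<and>
     (\<forall>v w. T (v + w) = (\<lambda>x. T v x + T w x)) \<and> (\<forall>c v. T (sm c v) = (\<lambda>x. c * T v x)) \<and>
     (\<forall>g\<in>G. \<forall>v. T (\<pi> g v) = (\<lambda>x. T v (x ** g))))"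

text \<open>A subquotient of the induced representation is a quotient \<open>p\<close> of an invariant subspace \<open>U\<close>.\<close>

definition subquotient_of_induced ::
  "('a::nonarch_local_field^4^4) set \<Rightarrow> (complex \<Rightarrow> 'v::ab_group_add \<Rightarrow> 'v) \<Rightarrow> ('a^4^4 \<Rightarrow> 'v \<Rightarrow> 'v)
     \<Rightarrow> ('a^4^4 \<Rightarrow> complex) set \<Rightarrow> bool" where
  "subquotient_of_induced G sm \<pi> S \<longleftrightarrow> (\<exists>U p. U \<subseteq> S \<and> (\<lambda>x. 0) \<in> U \<and>
     (\<forall>f\<in>U. \<forall>h\<in>U. (\<lambda>x. f x + h x) \<in> U \<and> p (\<lambda>x. f x + h x) = p f + p h) \<and>
     (\<forall>c. \<forall>f\<in>U. (\<lambda>x. c * f x) \<in> U \<and> p (\<lambda>x. c * f x) = sm c (p f)) \<and>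
     (\<forall>g\<in>G. \<forall>f\<in>U. (\<lambda>x. f (x ** g)) \<in> U \<and> p (\<lambda>x. f (x ** g)) = \<pi> g (p f)) \<and>
     p ` U = UNIV)"

definition GL4_delta_B :: "'a::nonarch_local_field^4^4 \<Rightarrow> real" where
  "GL4_delta_B b = absv (b$1$1) ^ 3 * absv (b$2$2) / (absv (b$3$3) * absv (b$4$4) ^ 3)"

definition I_GL4 :: "('a::nonarch_local_field \<Rightarrow> complex) \<Rightarrow> ('a \<Rightarrow> complex) \<Rightarrow> ('a \<Rightarrow> complex)
    \<Rightarrow> ('a \<Rightarrow> complex) \<Rightarrow> ('a^4^4 \<Rightarrow> complex) set" where
  "I_GL4 c1 c2 c3 c4 = induced GL4 {b \<in> GL4. upper_triangular b}
     (\<lambda>b. c1 (b$1$1) * c2 (b$2$2) * c3 (b$3$3) * c4 (b$4$4) * of_real (sqrt (GL4_delta_B b)))"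

definition Ind_siegel :: "complex \<Rightarrow> ('a::nonarch_local_field^4^4 \<Rightarrow> complex) set" where
  "Ind_siegel s = induced GSp4 siegel_parabolic
     (\<lambda>p. of_real (siegel_delta p) powr ((s + 1) / 3))"


section \<open>Satake parameters and the standard L-factor\<close>

definition satake_matrix :: "complex \<Rightarrow> complex \<Rightarrow> complex^4^4" where
  "satake_matrix t1 t2 = diag4 t1 t2 (inverse t2) (inverse t1)"

text \<open>
  Let a, b be the first two diagonal entries and m the multiplier of an element of the Borel
  subgroup of the symplectic similitude group.  The positive roots are a/b, ab/m, aa/m, bb/m,
  whence the modulus character.  Under the duality of the projective similitude group with the
  complex group \<open>Sp(4)\<close> (so that the simple coroots of the former are the simple roots of the
  latter) the coordinates t1, t2 of the dual torus are the values at a uniformizer of the inducing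
  character along the cocharacters \<open>diag(x,x,1,1)\<close> and \<open>diag(x,1,x,1)\<close>.  The unramified character
  of the torus, trivial on the centre, with \<open>chi1\<close>, \<open>chi2\<close> along these cocharacters is
  \<open>(chi1 chi2)(a) (chi1 / chi2)(b) / chi1(m)\<close>.
\<close>

definition GSp4_delta_B :: "'a::nonarch_local_field^4^4 \<Rightarrow> real" where
  "GSp4_delta_B b = absv (b$1$1) ^ 4 * absv (b$2$2) ^ 2 / absv (multiplier b) ^ 3"

definition I_GSp4 :: "('a::nonarch_local_field \<Rightarrow> complex) \<Rightarrow> ('a \<Rightarrow> complex) \<Rightarrow> ('a^4^4 \<Rightarrow> complex) set"
  where
  "I_GSp4 chi1 chi2 = induced GSp4 {b \<in> GSp4. upper_triangular b}
     (\<lambda>b. chi1 (b$1$1) * chi2 (b$1$1) * (chi1 (b$2$2) / chi2 (b$2$2)) / chi1 (multiplier b)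
           * of_real (sqrt (GSp4_delta_B b)))"

definition unramified_PGSp4_with_satake ::
  "'a::nonarch_local_field \<Rightarrow> (complex \<Rightarrow> 'w::ab_group_add \<Rightarrow> 'w) \<Rightarrow> ('a^4^4 \<Rightarrow> 'w \<Rightarrow> 'w)
     \<Rightarrow> complex^4^4 \<Rightarrow> bool" where
  "unramified_PGSp4_with_satake p sm \<sigma> g \<longleftrightarrow>
     smooth_rep GSp4 sm \<sigma> \<and> trivial_centre \<sigma> \<and> irreducible_rep GSp4 sm \<sigma> \<and>
     (\<exists>v. spherical_vector GSp4_integral \<sigma> v) \<and>
     (\<exists>chi1 chi2. unramified_character chi1 \<and> unramified_character chi2 \<and>
        g = satake_matrix (chi1 p) (chi2 p) \<and> subquotient_of_induced GSp4 sm \<sigma> (I_GSp4 chi1 chi2))"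

text \<open>The eigenvalues of the image of the torus element \<open>g\<close> in the 5-dimensional
  representation, with multiplicity.\<close>

definition std_eigenvalues :: "complex^4^4 \<Rightarrow> complex list" where
  "std_eigenvalues g = (let t1 = g$1$1; t2 = g$2$2 in
     [t1 * t2, t1 * inverse t2, 1, inverse t1 * t2, inverse t1 * inverse t2])"

text \<open>The standard L-factor of the unramified representation with Satake parameter \<open>g\<close>.\<close>

definition L_std :: "nat \<Rightarrow> complex^4^4 \<Rightarrow> complex \<Rightarrow> complex" where
  "L_std q g s = (\<Prod>l\<leftarrow>std_eigenvalues g. inverse (1 - l * of_nat q powr (- s)))"


section \<open>Alternating sums\<close>

text \<open>Laurent polynomials in two variables: the group algebra of the lattice of exponents (a,b).\<close>

type_synonym laurent = "(int \<times> int) \<Rightarrow>\<^sub>0 complex"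

definition e_exp :: "int \<times> int \<Rightarrow> laurent" where
  "e_exp k = Poly_Mapping.single k 1"

definition const_laurent :: "complex \<Rightarrow> laurent" where
  "const_laurent c = Poly_Mapping.single 0 c"

definition laurent_at :: "laurent \<Rightarrow> complex^4^4 \<Rightarrow> complex" where
  "laurent_at f g =
     (\<Sum>k\<in>Poly_Mapping.keys f. Poly_Mapping.lookup f k * (g$1$1) powi fst k * (g$2$2) powi snd k)"

text \<open>The triple \<open>(sw, e, d)\<close> encodes the signed permutation that first swaps the
  two exponents if \<open>sw\<close> holds and then multiplies them by the signs \<open>e\<close> and \<open>d\<close>.\<close>

definition signed_perms :: "(bool \<times> int \<times> int) set" where
  "signed_perms = UNIV \<times> {1, -1} \<times> {1, -1}"

fun sp_apply :: "bool \<times> int \<times> int \<Rightarrow> int \<times> int \<Rightarrow> int \<times> int" where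
  "sp_apply (sw, e, d) (a, b) = (if sw then (e * b, d * a) else (e * a, d * b))"

fun sp_det :: "bool \<times> int \<times> int \<Rightarrow> int" where
  "sp_det (sw, e, d) = (if sw then - (e * d) else e * d)"

definition sp_act :: "bool \<times> int \<times> int \<Rightarrow> laurent \<Rightarrow> laurent" where
  "sp_act \<omega> f =
     (\<Sum>k\<in>Poly_Mapping.keys f. Poly_Mapping.single (sp_apply \<omega> k) (Poly_Mapping.lookup f k))"

definition alternator :: "laurent \<Rightarrow> laurent" where
  "alternator f = (\<Sum>\<omega>\<in>signed_perms. of_int (sp_det \<omega>) * sp_act \<omega> f)"

definition rho_check :: "int \<times> int" where
  "rho_check = (2, 1)"

text \<open>
  The quotient \<open>\<A>(f) / \<A>(e^\<rho>)\<close> is an exact quotient of Laurent polynomials (as in the Weyl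
  character formula).  Forming it before evaluation gives it its meaning at those \<open>g\<close> where the
  denominator vanishes.
\<close>

definition weyl_quotient :: "laurent \<Rightarrow> laurent" where
  "weyl_quotient f = (THE p. p * alternator (e_exp rho_check) = alternator f)"

definition shalika_numerator :: "nat \<Rightarrow> nat \<Rightarrow> laurent" where
  "shalika_numerator q n =
     e_exp (rho_check + (int n, int n))
       * (1 - const_laurent (1 / of_nat q) * e_exp (-1, -1))
       * (1 - const_laurent (1 / of_nat q) * e_exp (-1, 1))"


section \<open>Measures and the zeta integral\<close>

definition haar_units :: "'a::nonarch_local_field measure \<Rightarrow> bool" where
  "haar_units M \<longleftrightarrow> sets M = sets (restrict_space borel (UNIV - {0})) \<and>
     (\<forall>a A. a \<noteq> 0 \<longrightarrow> A \<in> sets M \<longrightarrow> emeasure M ((\<lambda>x. a * x) ` A) = emeasure M A) \<and>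
     emeasure M {x. absv x = 1} = 1"

definition haar_GSp4_integral :: "('a::nonarch_local_field^4^4) measure \<Rightarrow> bool" where
  "haar_GSp4_integral M \<longleftrightarrow> sets M = sets (restrict_space borel GSp4_integral) \<and>
     (\<forall>a A. a \<in> GSp4_integral \<longrightarrow> A \<in> sets M \<longrightarrow> emeasure M ((\<lambda>x. a ** x) ` A) = emeasure M A) \<and>
     emeasure M GSp4_integral = 1"

definition quotient_integrand ::
  "('a::nonarch_local_field^4^4 \<Rightarrow> complex) \<Rightarrow> 'a \<Rightarrow> 'a^4^4 \<Rightarrow> complex" where
  "quotient_integrand \<Phi> \<mu> k = of_real (inverse (siegel_delta (siegel_m \<mu>))) * \<Phi> (siegel_m \<mu> ** k)"

definition quotient_integrable ::
  "'a::nonarch_local_field measure \<Rightarrow> ('a^4^4) measure \<Rightarrow> ('a^4^4 \<Rightarrow> complex) \<Rightarrow> bool" where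
  "quotient_integrable dmu dk \<Phi> \<longleftrightarrow>
     integrable (dmu \<Otimes>\<^sub>M dk) (\<lambda>(\<mu>, k). quotient_integrand \<Phi> \<mu> k)"

definition quotient_integral ::
  "'a::nonarch_local_field measure \<Rightarrow> ('a^4^4) measure \<Rightarrow> ('a^4^4 \<Rightarrow> complex) \<Rightarrow> complex" where
  "quotient_integral dmu dk \<Phi> = (LINT \<mu>|dmu. LINT k|dk. quotient_integrand \<Phi> \<mu> k)"


section \<open>Consistency of the modulus character\<close>

lemma vector_4:
  "(vector [x,y,z,w] :: 'a::zero^4) $ 1 = x"
  "(vector [x,y,z,w] :: 'a::zero^4) $ 2 = y"
  "(vector [x,y,z,w] :: 'a::zero^4) $ 3 = z"
  "(vector [x,y,z,w] :: 'a::zero^4) $ 4 = w"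
  unfolding vector_def by simp_all

lemma UNIV_4: "(UNIV :: 4 set) = {1, 2, 3, 4}"
  using exhaust_4 by blast

lemma sum_UNIV_4: "sum f (UNIV :: 4 set) = f 1 + f 2 + f 3 + f 4"
  unfolding UNIV_4 by (simp add: ac_simps)

lemma siegel_delta_siegel_element:
  fixes g B :: "'a::nonarch_local_field^2^2"
  assumes "invertible g" "siegel_element g B \<mu> \<in> GSp4"
  shows "multiplier (siegel_element g B \<mu>) = \<mu>"
    and "siegel_delta (siegel_element g B \<mu>) = absv (det g / \<mu>) ^ 3"
proof -
  define G where "G = matrix_inv g"
  define p where "p = siegel_element g B \<mu>"
  have "G ** g = mat 1"
    using assms(1) unfolding G_def invertible_def matrix_inv_def by (metis (mono_tags, lifting) someI_ex)
  then have "(G ** g)$1$1 = 1"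
    by (simp add: mat_def)
  then have inv: "G$1$1 * g$1$1 + G$1$2 * g$2$1 = 1"
    by (simp add: matrix_matrix_mult_def sum_2)
  have entry: "(transpose p ** J4 ** p)$1$4 = \<mu>"
  proof -
    have "(transpose p ** J4 ** p)$1$4 = \<mu> * (G$1$1 * g$1$1 + G$1$2 * g$2$1)"
      unfolding p_def siegel_element_def G_def [symmetric]
      by (simp add: matrix_matrix_mult_def transpose_def block_def J4_def J2_def mat_def
          sum_UNIV_4 sum_2 vector_4 algebra_simps)
    then show ?thesis
      by (simp add: inv)
  qed
  have J_entry: "(mat m ** J4)$1$4 = m" for m :: 'a
    by (simp add: matrix_matrix_mult_def block_def J4_def J2_def mat_def sum_UNIV_4 vector_4)
  obtain m where m: "transpose p ** J4 ** p = mat m ** J4"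
    using assms(2) unfolding p_def GSp4_def by blast
  have uniq: "m' = \<mu>" if "transpose p ** J4 ** p = mat m' ** J4" for m'
    using that entry J_entry by metis
  have mult: "multiplier p = \<mu>"
    unfolding multiplier_def by (rule the_equality, rule m [unfolded uniq [OF m]], erule uniq)
  then show "multiplier (siegel_element g B \<mu>) = \<mu>"
    by (simp add: p_def)
  have "upper_left p = g"
    unfolding p_def siegel_element_def
    by (simp add: upper_left_def block_def vector_4 vec_eq_iff forall_2)
  then show "siegel_delta (siegel_element g B \<mu>) = absv (det g / \<mu>) ^ 3"
    using mult by (simp add: siegel_delta_def p_def)
qed

end

theory Submission
  imports Defs "HOL-Probability.Probability_Measure"
begin

text \<open>
  By sphericity the integrand depends on \<open>\<mu>\<close> only through its absolute value, so the integral is a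
  series over the shells of \<open>F\<close>, each of volume 1.  Since \<open>\<psi>\<close> has conductor the ring of integers, the
  Shalika function vanishes on the shells with \<open>|\<mu>| < 1\<close>; on the others the alternating sum collapses
  to \<open>(1 + 1/q) (\<chi>_n - \<chi>_(n-1) / q)\<close>, where \<open>\<chi>_n\<close> is the character of highest weight \<open>(n, n)\<close>.
  The Weyl character formula exhibits \<open>\<chi>_n\<close> as a combination of n-th powers of the four nontrivial
  weights of the standard representation, so that \<open>\<chi>_n\<close> satisfies a linear recurrence of order four
  and \<open>\<Sum> \<chi>_n x^n\<close> is \<open>1 - x^2\<close> times the standard L-factor at \<open>x = q^(-s)\<close>.  The zeta values in
  \<open>f\<close> cancel the factors \<open>1 - x/q\<close> and \<open>1 - x^2\<close>.
\<close>

section \<open>Laurent polynomials and the Weyl character formula\<close>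

lemma laurent_at_add: "laurent_at (p + r) g = laurent_at p g + laurent_at r g"
  unfolding laurent_at_def
  by (rule setsum_keys_plus_distrib) (simp_all add: algebra_simps)

lemma laurent_at_single:
  "laurent_at (Poly_Mapping.single k c) g = c * (g$1$1) powi fst k * (g$2$2) powi snd k"
  by (simp add: laurent_at_def)

text \<open>Additive statements then need checking on monomials only; adding a monomial, unlike
  updating a coefficient, carries no freshness condition.\<close>

lemma poly_mapping_add_single_induct [case_names zero add_single]:
  assumes "P 0" and step: "\<And>p k c. P p \<Longrightarrow> P (p + Poly_Mapping.single k c)"
  shows "P (p :: 'a \<Rightarrow>\<^sub>0 'b::comm_monoid_add)"
proof (induction p rule: update_induct)
  case (update p k c)
  have "Poly_Mapping.update k c p = p + Poly_Mapping.single k c"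
    using update(1) by (intro poly_mapping_eqI)
      (auto simp: lookup_update lookup_add lookup_single when_def in_keys_iff)
  then show ?case
    using step update by simp
qed (rule assms)

text \<open>Biadditivity reduces this to monomials, where nonzero coordinates turn sums of integer
  exponents into products of powers.\<close>

lemma laurent_at_mult:
  assumes "g$1$1 \<noteq> 0" "g$2$2 \<noteq> 0"
  shows "laurent_at (p * r) g = laurent_at p g * laurent_at r g"
proof (induction p rule: poly_mapping_add_single_induct)
  case zero
  then show ?case by (simp add: laurent_at_def)
next
  case (add_single p k c)
  have "laurent_at (Poly_Mapping.single k c * r) g
      = laurent_at (Poly_Mapping.single k c) g * laurent_at r g"
  proof (induction r rule: poly_mapping_add_single_induct)
    case zero
    then show ?case by (simp add: laurent_at_def)
  next
    case (add_single r l d)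
    then show ?case
      using assms
      by (simp add: distrib_left laurent_at_add mult_single laurent_at_single power_int_add ac_simps)
  qed
  with add_single show ?case
    by (simp add: distrib_right laurent_at_add)
qed

lemma laurent_at_uminus: "laurent_at (- p) g = - laurent_at p g"
proof -
  have "laurent_at (- p) g + laurent_at p g = laurent_at 0 g"
    by (simp flip: laurent_at_add)
  then show ?thesis
    by (simp add: laurent_at_def add_eq_0_iff2)
qed

lemma laurent_at_diff: "laurent_at (p - r) g = laurent_at p g - laurent_at r g"
  using laurent_at_add [of p "- r" g] by (simp add: laurent_at_uminus)

section \<open>Alternating sums over the signed permutations\<close>

lemma sp_act_add: "sp_act w (p + r) = sp_act w p + sp_act w r"
  unfolding sp_act_def
  by (rule setsum_keys_plus_distrib) (simp_all add: single_add)

lemma sp_act_single: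
  "sp_act w (Poly_Mapping.single k c) = Poly_Mapping.single (sp_apply w k) c"
  by (simp add: sp_act_def)

lemma alternator_add: "alternator (p + r) = alternator p + alternator r"
  by (simp add: alternator_def sp_act_add algebra_simps sum.distrib)

lemma alternator_single:
  "alternator (Poly_Mapping.single (a, b) c) =
     Poly_Mapping.single (a, b) c - Poly_Mapping.single (a, - b) c
     - Poly_Mapping.single (- a, b) c + Poly_Mapping.single (- a, - b) c
     - Poly_Mapping.single (b, a) c + Poly_Mapping.single (b, - a) c
     + Poly_Mapping.single (- b, a) c - Poly_Mapping.single (- b, - a) c"
  by (simp add: alternator_def signed_perms_def sum.cartesian_product [symmetric] UNIV_bool
      sp_act_single)

lemma alternator_single_const:
  "alternator (Poly_Mapping.single k c) = const_laurent c * alternator (e_exp k)"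
  by (cases k) (simp add: alternator_single e_exp_def const_laurent_def ring_distribs mult_single)

text \<open>The coefficients of \<open>p\<close> are invariant under translation by
  \<open>k\<close>, so a nonzero one would recur at infinitely many exponents, against finite
  support.\<close>

lemma mult_one_minus_e_exp_eq_0:
  assumes "k \<noteq> 0" "p * (1 - e_exp k) = 0"
  shows "p = 0"
proof (rule ccontr)
  assume "p \<noteq> 0"
  then obtain j where j: "Poly_Mapping.lookup p j \<noteq> 0"
    by (metis lookup_zero poly_mapping_eqI)
  have shift: "Poly_Mapping.lookup (r * e_exp k) (i + k) = Poly_Mapping.lookup r i" for r i
    by (induction r rule: poly_mapping_add_single_induct)
      (simp_all add: distrib_right lookup_add e_exp_def mult_single lookup_single when_def)
  have "p = p * e_exp k"
    using assms(2) by (simp add: right_diff_distrib)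
  then have step: "Poly_Mapping.lookup p (i + k) = Poly_Mapping.lookup p i" for i
    using shift by metis
  define h where "h n = (fst j + int n * fst k, snd j + int n * snd k)" for n
  have "Poly_Mapping.lookup p (h n) = Poly_Mapping.lookup p j" for n
  proof (induction n)
    case (Suc n)
    have "h (Suc n) = h n + k"
      by (simp add: h_def prod_eq_iff algebra_simps)
    then show ?case using Suc step by simp
  qed (simp add: h_def)
  then have "range h \<subseteq> Poly_Mapping.keys p"
    using j by (auto simp: in_keys_iff)
  moreover have "inj h"
    using assms(1) by (auto simp: inj_def h_def prod_eq_iff)
  ultimately show False
    using finite_subset finite_keys range_inj_infinite by metis
qed

text \<open>Weyl denominator formula of type C2: one factor for the negative of each positive root
  (1,-1), (1,1), (2,0), (0,2).\<close>

lemma alternator_rho_factors: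
  "alternator (e_exp rho_check) =
     e_exp (2, 1) * (1 - e_exp (- 1, 1)) * (1 - e_exp (- 1, - 1)) * (1 - e_exp (- 2, 0)) * (1 - e_exp (0, - 2))"
  unfolding rho_check_def e_exp_def alternator_single
  by (simp add: ring_distribs mult_single flip: single_one)

text \<open>The root factors cancel one at a time, and the remaining monomial is a unit. This is the
  uniqueness that gives \<open>weyl_quotient\<close> its meaning.\<close>

lemma mult_alternator_rho_cancel:
  assumes "p * alternator (e_exp rho_check) = r * alternator (e_exp rho_check)"
  shows "p = r"
proof -
  have "(p - r) * alternator (e_exp rho_check) = 0"
    using assms by (simp add: left_diff_distrib)
  then have "(p - r) * e_exp (2, 1) = 0"
    unfolding alternator_rho_factors mult.assoc [symmetric]
    by (auto dest!: mult_one_minus_e_exp_eq_0 [rotated] simp: zero_prod_def)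
  then have "(p - r) * (e_exp (2, 1) * e_exp (- 2, - 1)) = 0"
    by (simp flip: mult.assoc)
  then show ?thesis
    by (simp add: e_exp_def mult_single flip: zero_prod_def)
qed

lemma weyl_quotient_eqI:
  "p * alternator (e_exp rho_check) = alternator f \<Longrightarrow> weyl_quotient f = p"
  unfolding weyl_quotient_def by (rule the_equality) (auto intro: mult_alternator_rho_cancel)

text \<open>The quartic is (X - u)(X - u')(X - v)(X - v'); the two inverse pairs make its
  coefficients palindromic.\<close>

lemma quartic_root:
  fixes w :: "'a::comm_ring_1"
  assumes "u * u' = 1" "v * v' = 1" "w \<in> {u, u', v, v'}"
  shows "w ^ 4 = (u + u' + v + v') * w ^ 3 - (2 + (u + u') * (v + v')) * w ^ 2
    + (u + u' + v + v') * w - 1"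
proof -
  have "(w ^ 2 - (u + u') * w + u * u') * (w ^ 2 - (v + v') * w + v * v') =
      (w - u) * (w - u') * (w - v) * (w - v')"
    by (simp add: algebra_simps power2_eq_square)
  also have "\<dots> = 0"
    using assms(3) by auto
  finally show ?thesis
    unfolding assms by (simp add: algebra_simps power2_eq_square power3_eq_cube power4_eq_xxxx)
qed

text \<open>Elementary symmetric functions of degrees 1 and 2 in the four nontrivial weights of the
  standard representation; those of degrees 3 and 4 are \<open>std_esym1\<close> and 1. The constant
  2 in \<open>std_esym2\<close> comes from the two inverse pairs.\<close>

definition std_esym1 :: laurent where
  "std_esym1 = e_exp (1, 1) + e_exp (- 1, - 1) + e_exp (1, - 1) + e_exp (- 1, 1)"

definition std_esym2 :: laurent where
  "std_esym2 = 2 + (e_exp (1, 1) + e_exp (- 1, - 1)) * (e_exp (1, - 1) + e_exp (- 1, 1))"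

lemma alternator_e_exp:
  "alternator (e_exp (a, b)) =
     e_exp (a, b) - e_exp (a, - b) - e_exp (- a, b) + e_exp (- a, - b)
     - e_exp (b, a) + e_exp (b, - a) + e_exp (- b, a) - e_exp (- b, - a)"
  unfolding e_exp_def by (rule alternator_single)

text \<open>Along the diagonal each of the eight monomials runs through a geometric progression
  whose ratio is one of the four weights, and all four are roots of the same quartic.\<close>

lemma alternator_recurrence:
  "alternator (e_exp (a + 4, b + 4)) =
     std_esym1 * alternator (e_exp (a + 3, b + 3)) - std_esym2 * alternator (e_exp (a + 2, b + 2))
     + std_esym1 * alternator (e_exp (a + 1, b + 1)) - alternator (e_exp (a, b))"
proof -
  have e_mult: "e_exp k * e_exp l = e_exp (k + l)" for k l
    by (simp add: e_exp_def mult_single)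
  have e_0: "e_exp (0, 0) = 1"
    by (simp add: e_exp_def flip: zero_prod_def)
  \<comment> \<open>The direction \<open>(c, d)\<close> is a nontrivial weight of the standard
    representation, so its monomial \<open>w\<close> is a root of the quartic.\<close>
  have rec: "e_exp (a + 4 * c, b + 4 * d) = std_esym1 * e_exp (a + 3 * c, b + 3 * d)
      - std_esym2 * e_exp (a + 2 * c, b + 2 * d) + std_esym1 * e_exp (a + c, b + d) - e_exp (a, b)"
    if "c \<in> {1, - 1}" "d \<in> {1, - 1}" for a b c d
  proof -
    define w where "w = e_exp (c, d)"
    have shift: "e_exp (a + int n * c, b + int n * d) = e_exp (a, b) * w ^ n" for n
    proof (induction n)
      case (Suc n)
      have "e_exp (a + int (Suc n) * c, b + int (Suc n) * d) = e_exp (a + int n * c, b + int n * d) * w"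
        by (simp add: w_def e_mult algebra_simps)
      then show ?case by (simp only: Suc power_Suc2 mult.assoc)
    qed simp
    have "w ^ 4 = std_esym1 * w ^ 3 - std_esym2 * w ^ 2 + std_esym1 * w - 1"
      using quartic_root [of "e_exp (1, 1)" "e_exp (- 1, - 1)" "e_exp (1, - 1)" "e_exp (- 1, 1)" w] that
      by (auto simp: w_def e_mult e_0 std_esym1_def std_esym2_def add.assoc)
    then have "e_exp (a, b) * w ^ 4 = std_esym1 * (e_exp (a, b) * w ^ 3)
        - std_esym2 * (e_exp (a, b) * w ^ 2) + std_esym1 * (e_exp (a, b) * w) - e_exp (a, b)"
      by (simp only:) (simp add: algebra_simps)
    then show ?thesis
      using shift [of 1] shift [of 2] shift [of 3] shift [of 4] by simp
  qed
  have "e_exp (a + 4, b + 4) = std_esym1 * e_exp (a + 3, b + 3)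
      - std_esym2 * e_exp (a + 2, b + 2) + std_esym1 * e_exp (a + 1, b + 1) - e_exp (a, b)"
    "e_exp (a + 4, - (b + 4)) = std_esym1 * e_exp (a + 3, - (b + 3))
      - std_esym2 * e_exp (a + 2, - (b + 2)) + std_esym1 * e_exp (a + 1, - (b + 1)) - e_exp (a, - b)"
    "e_exp (- (a + 4), b + 4) = std_esym1 * e_exp (- (a + 3), b + 3)
      - std_esym2 * e_exp (- (a + 2), b + 2) + std_esym1 * e_exp (- (a + 1), b + 1) - e_exp (- a, b)"
    "e_exp (- (a + 4), - (b + 4)) = std_esym1 * e_exp (- (a + 3), - (b + 3))
      - std_esym2 * e_exp (- (a + 2), - (b + 2)) + std_esym1 * e_exp (- (a + 1), - (b + 1)) - e_exp (- a, - b)"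
    for a b
    using rec [of 1 1 a b] rec [of 1 "- 1" a "- b"] rec [of "- 1" 1 "- a" b]
      rec [of "- 1" "- 1" "- a" "- b"]
    by simp_all
  \<comment> \<open>Four of the eight monomials start from \<open>(a, b)\<close>, the other four
    from the swapped pair.\<close>
  note terms = this [of a b] this [of b a]
  show ?thesis
    unfolding alternator_e_exp unfolding terms by (simp add: algebra_simps)
qed

text \<open>
  The value at \<open>n + 3\<close> is the irreducible character of highest weight \<open>(n, n)\<close>; the shift
  makes room for the values at \<open>n = -3, -2, -1\<close> given by the Weyl character formula.
\<close>

fun weyl_char :: "nat \<Rightarrow> laurent" where
  "weyl_char 0 = - 1"
| "weyl_char (Suc 0) = 0"
| "weyl_char (Suc (Suc 0)) = 0"
| "weyl_char (Suc (Suc (Suc 0))) = 1"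
| "weyl_char (Suc (Suc (Suc (Suc n)))) =
     std_esym1 * weyl_char (Suc (Suc (Suc n))) - std_esym2 * weyl_char (Suc (Suc n))
     + std_esym1 * weyl_char (Suc n) - weyl_char n"

text \<open>Both sides satisfy the same recurrence. The exponent is (n - 3, n - 3) plus rho: it is
  an odd image of rho for n = 0, has a zero coordinate, hence alternating sum 0, for n = 1, 2, and
  is rho itself for n = 3.\<close>

lemma weyl_char_formula:
  "weyl_char n * alternator (e_exp rho_check) = alternator (e_exp (int n - 1, int n - 2))"
proof (induction n rule: weyl_char.induct)
  case (5 n)
  have "alternator (e_exp (int n - 1 + 4, int n - 2 + 4)) =
      (std_esym1 * weyl_char (Suc (Suc (Suc n))) - std_esym2 * weyl_char (Suc (Suc n))
       + std_esym1 * weyl_char (Suc n) - weyl_char n) * alternator (e_exp rho_check)"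
    unfolding alternator_recurrence ring_distribs left_diff_distrib mult.assoc 5
    by (simp add: algebra_simps)
  then show ?case by (simp add: algebra_simps)
qed (simp_all add: rho_check_def alternator_e_exp)

text \<open>The product expands into four monomials. Swapping coordinates turns the last two into
  minus the first two up to constants, and the common factor 1 + 1/q appears.\<close>

lemma weyl_quotient_shalika_numerator:
  assumes "q > 0"
  shows "weyl_quotient (shalika_numerator q n) =
    const_laurent (1 + 1 / of_nat q) *
      (weyl_char (n + 3) - const_laurent (1 / of_nat q) * weyl_char (n + 2))"
proof (rule weyl_quotient_eqI)
  define c :: complex where "c = 1 / of_nat q"
  let ?D = "alternator (e_exp rho_check)"
  let ?s = "Poly_Mapping.single :: _ \<Rightarrow> complex \<Rightarrow> _"
  have num: "shalika_numerator q n = ?s (2 + int n, 1 + int n) 1 + ?s (1 + int n, int n) (- c)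
      + ?s (1 + int n, 2 + int n) (- c) + ?s (int n, int n + 1) (c ^ 2)"
    by (simp add: shalika_numerator_def rho_check_def e_exp_def const_laurent_def ring_distribs
        mult_single c_def [symmetric] single_uminus power2_eq_square)
  have swap: "alternator (e_exp (a, b)) = - alternator (e_exp (b, a))" for a b
    by (simp add: alternator_e_exp)
  have "alternator (shalika_numerator q n) =
      const_laurent 1 * (weyl_char (n + 3) * ?D) + const_laurent (- c) * (weyl_char (n + 2) * ?D)
      + const_laurent (- c) * (- (weyl_char (n + 3) * ?D)) + const_laurent (c ^ 2) * (- (weyl_char (n + 2) * ?D))"
    unfolding num alternator_add alternator_single_const weyl_char_formula
    unfolding swap [of "1 + int n" "2 + int n"] swap [of "int n" "int n + 1"]
    by (simp add: algebra_simps)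
  also have "\<dots> = const_laurent (1 + c) * (weyl_char (n + 3) - const_laurent c * weyl_char (n + 2)) * ?D"
    by (simp add: const_laurent_def single_add single_uminus power2_eq_square algebra_simps
        flip: mult_single [of 0 _ 0, simplified])
  finally show "const_laurent (1 + 1 / of_nat q) *
      (weyl_char (n + 3) - const_laurent (1 / of_nat q) * weyl_char (n + 2)) * ?D
      = alternator (shalika_numerator q n)"
    by (simp add: c_def)
qed

section \<open>Generating functions\<close>

text \<open>The solution is a Cauchy product with the geometric series of \<open>r\<close>, hence
  absolutely summable; summing the recurrence itself gives the value.\<close>

lemma first_order_recurrence_series:
  fixes a b :: "nat \<Rightarrow> complex"
  assumes "cmod r < 1" and b: "summable (\<lambda>n. cmod (b n))" and rec: "\<And>n. a (Suc n) = r * a n + b n"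
  shows "summable (\<lambda>n. cmod (a n))" and "(1 - r) * suminf a = a 0 + suminf b"
proof -
  \<comment> \<open>The initial value becomes the zeroth term of the inhomogeneity.\<close>
  define c where "c = case_nat (a 0) b"
  have c: "summable (\<lambda>n. cmod (c n))"
    using b by (subst summable_Suc_iff [symmetric]) (simp add: c_def)
  have a_eq: "a n = (\<Sum>i\<le>n. c i * r ^ (n - i))" for n
  proof (induction n)
    case (Suc n)
    have "(\<Sum>i\<le>Suc n. c i * r ^ (Suc n - i)) = (\<Sum>i\<le>n. r * (c i * r ^ (n - i))) + c (Suc n)"
      by (simp add: Suc_diff_le algebra_simps)
    then show ?case
      by (simp add: rec Suc sum_distrib_left c_def)
  qed (simp add: c_def)
  show summable: "summable (\<lambda>n. cmod (a n))"
  proof (rule summable_comparison_test')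
    show "summable (\<lambda>n. \<Sum>i\<le>n. cmod (c i) * cmod r ^ (n - i))"
      using c assms(1) by (intro summable_Cauchy_product) (simp_all add: summable_geometric)
    have "cmod (a n) \<le> (\<Sum>i\<le>n. cmod (c i * r ^ (n - i)))" for n
      unfolding a_eq by (rule norm_sum)
    then show "norm (cmod (a n)) \<le> (\<Sum>i\<le>n. cmod (c i) * cmod r ^ (n - i))" for n
      by (simp add: norm_mult norm_power)
  qed
  have "(\<lambda>n. a (Suc n)) sums (r * suminf a + suminf b)"
    unfolding rec by (intro sums_add sums_mult summable_sums summable_norm_cancel [OF summable]
        summable_norm_cancel [OF b])
  moreover have "suminf a = a 0 + suminf (\<lambda>n. a (Suc n))"
    using suminf_split_head [OF summable_norm_cancel [OF summable]] by simp
  ultimately show "(1 - r) * suminf a = a 0 + suminf b"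
    by (simp add: sums_iff algebra_simps)
qed

text \<open>The characteristic roots are peeled off one at a time, leaving four nested first-order
  recurrences. The right side is the numerator polynomial of the generating function, evaluated at
  1.\<close>

lemma fourth_order_recurrence_series:
  fixes z :: "nat \<Rightarrow> complex"
  assumes r: "cmod r1 < 1" "cmod r2 < 1" "cmod r3 < 1" "cmod r4 < 1"
    and rec: "\<And>n. z (n + 4) = (r1 + r2 + r3 + r4) * z (n + 3)
      - (r1 * r2 + r1 * r3 + r1 * r4 + r2 * r3 + r2 * r4 + r3 * r4) * z (n + 2)
      + (r1 * r2 * r3 + r1 * r2 * r4 + r1 * r3 * r4 + r2 * r3 * r4) * z (n + 1)
      - r1 * r2 * r3 * r4 * z n"
  shows "summable (\<lambda>n. cmod (z n))"
    and "(1 - r1) * (1 - r2) * (1 - r3) * (1 - r4) * suminf z =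
      z 0 + (z 1 - (r1 + r2 + r3 + r4) * z 0)
      + (z 2 - (r1 + r2 + r3 + r4) * z 1
         + (r1 * r2 + r1 * r3 + r1 * r4 + r2 * r3 + r2 * r4 + r3 * r4) * z 0)
      + (z 3 - (r1 + r2 + r3 + r4) * z 2
         + (r1 * r2 + r1 * r3 + r1 * r4 + r2 * r3 + r2 * r4 + r3 * r4) * z 1
         - (r1 * r2 * r3 + r1 * r2 * r4 + r1 * r3 * r4 + r2 * r3 * r4) * z 0)"
proof -
  \<comment> \<open>Each \<open>y\<close> applies the shift minus one root to its predecessor; the
    full recurrence says that \<open>y3\<close> is geometric with ratio \<open>r4\<close>.\<close>
  define y1 where "y1 n = z (Suc n) - r1 * z n" for n
  define y2 where "y2 n = y1 (Suc n) - r2 * y1 n" for n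
  define y3 where "y3 n = y2 (Suc n) - r3 * y2 n" for n
  have "y3 (Suc n) = r4 * y3 n + 0" for n
    using rec [of n] by (simp add: y3_def y2_def y1_def eval_nat_numeral algebra_simps)
  note s3 = first_order_recurrence_series [where a = y3 and b = "\<lambda>_. 0", OF r(4) _ this, simplified]
  have "y2 (Suc n) = r3 * y2 n + y3 n" for n
    by (simp add: y3_def)
  note s2 = first_order_recurrence_series [OF r(3) s3(1) this]
  have "y1 (Suc n) = r2 * y1 n + y2 n" for n
    by (simp add: y2_def)
  note s1 = first_order_recurrence_series [OF r(2) s2(1) this]
  have "z (Suc n) = r1 * z n + y1 n" for n
    by (simp add: y1_def)
  note s0 = first_order_recurrence_series [OF r(1) s1(1) this]
  show "summable (\<lambda>n. cmod (z n))"
    by (rule s0)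
  have "(1 - r1) * (1 - r2) * (1 - r3) * (1 - r4) * suminf z
      = (1 - r4) * ((1 - r3) * ((1 - r2) * ((1 - r1) * suminf z)))"
    by simp
  also have "\<dots> = (1 - r2) * (1 - r3) * (1 - r4) * z 0 + (1 - r3) * (1 - r4) * y1 0
      + (1 - r4) * y2 0 + y3 0"
    unfolding s0(2) distrib_left s1(2) s2(2) s3(2) by simp
  finally show "(1 - r1) * (1 - r2) * (1 - r3) * (1 - r4) * suminf z =
      z 0 + (z 1 - (r1 + r2 + r3 + r4) * z 0)
      + (z 2 - (r1 + r2 + r3 + r4) * z 1
         + (r1 * r2 + r1 * r3 + r1 * r4 + r2 * r3 + r2 * r4 + r3 * r4) * z 0)
      + (z 3 - (r1 + r2 + r3 + r4) * z 2
         + (r1 * r2 + r1 * r3 + r1 * r4 + r2 * r3 + r2 * r4 + r3 * r4) * z 1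
         - (r1 * r2 * r3 + r1 * r2 * r4 + r1 * r3 * r4 + r2 * r3 * r4) * z 0)"
    by (simp add: y3_def y2_def y1_def eval_nat_numeral algebra_simps)
qed

section \<open>The generating function of the characters at a Satake parameter\<close>

lemma laurent_at_1: "laurent_at 1 g = 1"
  using laurent_at_single [of 0 1 g] by simp

lemma laurent_at_const: "laurent_at (const_laurent c) g = c"
  by (simp add: const_laurent_def laurent_at_single)

text \<open>Multiplying numerator and denominator by \<open>1 - x\<close>, this is the generating function
  \<open>(1 - x^2) / ((1 - x) (1 - u x) (1 - x / u) (1 - v x) (1 - x / v))\<close> of the harmonic parts of the
  symmetric powers of the standard representation.\<close>

lemma weyl_char_series:
  fixes t1 t2 x :: complex
  defines "c \<equiv> \<lambda>n. laurent_at (weyl_char n) (satake_matrix t1 t2)"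
    and "u \<equiv> t1 * t2" and "v \<equiv> t1 * inverse t2"
    and "u' \<equiv> inverse t1 * inverse t2" and "v' \<equiv> inverse t1 * t2"
  assumes t: "t1 \<noteq> 0" "t2 \<noteq> 0"
    and small: "cmod (u * x) < 1" "cmod (u' * x) < 1" "cmod (v * x) < 1" "cmod (v' * x) < 1"
  shows "c 2 = 0" "summable (\<lambda>n. cmod (c (n + 3) * x ^ n))"
    and "(1 - u * x) * (1 - u' * x) * (1 - v * x) * (1 - v' * x) * suminf (\<lambda>n. c (n + 3) * x ^ n) = 1 + x"
proof -
  define g where "g = satake_matrix t1 t2"
  have g: "g$1$1 = t1" "g$2$2 = t2"
    by (simp_all add: g_def satake_matrix_def diag4_def vector_4)
  have uv: "u * u' = 1" "v * v' = 1"
    using t by (simp_all add: u_def u'_def v_def v'_def field_simps)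
  define e1 where "e1 = u + u' + v + v'"
  define e2 where "e2 = 2 + (u + u') * (v + v')"
  have mult: "laurent_at (p * r) g = laurent_at p g * laurent_at r g" for p r
    using t g by (intro laurent_at_mult) simp_all
  have e_at: "laurent_at (e_exp (a, b)) g = t1 powi a * t2 powi b" for a b
    by (simp add: e_exp_def laurent_at_single g)
  have std: "laurent_at std_esym1 g = e1"
    by (simp add: std_esym1_def laurent_at_add e_at power_int_minus e1_def u_def u'_def v_def v'_def)
  have "laurent_at 2 g = 2"
    using laurent_at_add [of 1 1 g] by (simp add: laurent_at_1)
  then have ext: "laurent_at std_esym2 g = e2"
    by (simp add: std_esym2_def laurent_at_add mult e_at power_int_minus e2_def u_def u'_def v_def v'_def)
  have c_init: "c 0 = - 1" "c 1 = 0" "c 2 = 0" "c 3 = 1"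
    by (simp_all add: c_def laurent_at_uminus laurent_at_1 numeral_2_eq_2 numeral_3_eq_3)
      (simp_all add: laurent_at_def)
  have c_rec: "c (n + 4) = e1 * c (n + 3) - e2 * c (n + 2) + e1 * c (n + 1) - c n" for n
    unfolding c_def g_def [symmetric]
    by (simp add: eval_nat_numeral laurent_at_add laurent_at_diff mult std ext)
  show "c 2 = 0"
    by (rule c_init)
  \<comment> \<open>The offset 3 makes \<open>z 0\<close> the term of the trivial character.\<close>
  define z where "z n = c (n + 3) * x ^ n" for n
  have E1: "u * x + u' * x + v * x + v' * x = e1 * x"
    by (simp add: e1_def algebra_simps)
  have E2: "(u * x) * (u' * x) + (u * x) * (v * x) + (u * x) * (v' * x) + (u' * x) * (v * x)
      + (u' * x) * (v' * x) + (v * x) * (v' * x) = e2 * x ^ 2"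
  proof -
    have "(u * x) * (u' * x) + (u * x) * (v * x) + (u * x) * (v' * x) + (u' * x) * (v * x)
      + (u' * x) * (v' * x) + (v * x) * (v' * x) = (u * u' + v * v' + (u + u') * (v + v')) * x ^ 2"
      by (simp add: algebra_simps power2_eq_square)
    then show ?thesis
      by (simp add: uv e2_def)
  qed
  have E3: "(u * x) * (u' * x) * (v * x) + (u * x) * (u' * x) * (v' * x) + (u * x) * (v * x) * (v' * x)
      + (u' * x) * (v * x) * (v' * x) = e1 * x ^ 3"
  proof -
    have "(u * x) * (u' * x) * (v * x) + (u * x) * (u' * x) * (v' * x) + (u * x) * (v * x) * (v' * x)
      + (u' * x) * (v * x) * (v' * x) = ((u * u') * (v + v') + (v * v') * (u + u')) * x ^ 3"
      by (simp add: algebra_simps power3_eq_cube)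
    then show ?thesis
      by (simp add: uv e1_def ac_simps)
  qed
  have E4: "(u * x) * (u' * x) * (v * x) * (v' * x) = x ^ 4"
  proof -
    have "(u * x) * (u' * x) * (v * x) * (v' * x) = (u * u') * (v * v') * x ^ 4"
      by (simp add: power4_eq_xxxx)
    then show ?thesis
      by (simp add: uv)
  qed
  have "c (n + 7) = e1 * c (n + 6) - e2 * c (n + 5) + e1 * c (n + 4) - c (n + 3)" for n
    using c_rec [of "n + 3"] unfolding add.assoc by simp
  then have "z (n + 4) = (e1 * c (n + 6) - e2 * c (n + 5) + e1 * c (n + 4) - c (n + 3)) * x ^ (n + 4)" for n
    unfolding z_def add.assoc by simp
  then have z_rec: "z (n + 4) = e1 * x * z (n + 3) - e2 * x ^ 2 * z (n + 2) + e1 * x ^ 3 * z (n + 1) - x ^ 4 * z n" for n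
    by (simp add: z_def power_add power4_eq_xxxx power3_eq_cube power2_eq_square algebra_simps)
  \<comment> \<open>The summand 1 in \<open>c 4\<close> stems from \<open>c 0 = - 1\<close>; it is
    what produces the \<open>x\<close> in the numerator \<open>1 + x\<close>.\<close>
  have c456: "c 4 = e1 + 1" "c 5 = e1 * c 4 - e2" "c 6 = e1 * c 5 - e2 * c 4 + e1"
    using c_init c_rec [of 0] c_rec [of 1] c_rec [of 2] by (simp_all add: eval_nat_numeral)
  note fourth_order_recurrence_series [of "u * x" "u' * x" "v * x" "v' * x" z,
      OF small, unfolded E1 E2 E3 E4, OF z_rec]
  moreover have "z 0 = 1" "z 1 = (e1 + 1) * x" "z 2 = (e1 ^ 2 + e1 - e2) * x ^ 2"
    "z 3 = (e1 * (e1 ^ 2 + e1 - e2) - e2 * (e1 + 1) + e1) * x ^ 3"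
    using c_init by (simp_all add: z_def c456 algebra_simps power2_eq_square)
  ultimately show "summable (\<lambda>n. cmod (c (n + 3) * x ^ n))"
    and "(1 - u * x) * (1 - u' * x) * (1 - v * x) * (1 - v' * x) * suminf (\<lambda>n. c (n + 3) * x ^ n) = 1 + x"
    by (simp_all add: z_def [symmetric])
      (simp_all add: algebra_simps power2_eq_square power3_eq_cube)
qed

section \<open>Integration over shells\<close>

lemma absv_eq_dist_0: "absv x = dist x 0"
  by (simp add: dist_absv)

lemma absv_0 [simp]: "absv 0 = 0"
  by (simp add: absv_eq_dist_0)

lemma absv_nonneg [simp]: "0 \<le> absv x"
  by (simp add: absv_eq_dist_0)

lemma absv_eq_0_iff [simp]: "absv x = 0 \<longleftrightarrow> x = 0"
  by (simp add: absv_eq_dist_0)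

lemma absv_pos_iff [simp]: "0 < absv x \<longleftrightarrow> x \<noteq> 0"
  by (simp add: absv_eq_dist_0)

lemma absv_1 [simp]: "absv 1 = 1"
  using absv_times [of 1 1] by (metis absv_eq_0_iff mult.right_neutral mult_cancel_left zero_neq_one)

lemma absv_minus [simp]: "absv (- x) = absv x"
  by (metis absv_eq_dist_0 diff_0 dist_absv dist_commute)

lemma absv_inverse: "absv (inverse x) = inverse (absv x)"
proof (cases "x = 0")
  case False
  then have "absv x * absv (inverse x) = 1"
    by (simp flip: absv_times)
  then show ?thesis
    by (rule inverse_unique [symmetric])
qed simp

lemma absv_divide: "absv (x / y) = absv x / absv y"
  by (simp add: divide_inverse absv_times absv_inverse)

lemma absv_power: "absv (x ^ n) = absv x ^ n"
  by (induction n) (simp_all add: absv_times)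

lemma absv_power_int: "absv (x powi n) = absv x powi n"
  by (simp add: power_int_def absv_power absv_inverse)

text \<open>Any two uniformizers bound each other in absolute value, and one with value 1/q
  exists.\<close>

lemma uniformizer_absv:
  assumes "uniformizer (p :: 'a::nonarch_local_field)"
  shows "absv p = 1 / real (residue_size TYPE('a))"
proof -
  obtain p' :: 'a where "absv p' < 1 \<and> (\<forall>x::'a. absv x < 1 \<longrightarrow> absv x \<le> absv p') \<and>
      absv p' = 1 / real (residue_size TYPE('a))"
    using ex_uniformizer [where 'a = 'a, folded residue_size_def [of "TYPE('a)"]] by (elim exE)
  with assms show ?thesis
    unfolding uniformizer_def by (metis order_antisym)
qed

lemma residue_size_ge_2: "residue_size TYPE('a::nonarch_local_field) \<ge> 2"
proof -
  have "{x :: 'a. absv x \<le> 1} \<noteq> {}"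
    using absv_0 by (metis (mono_tags) empty_Collect_eq zero_le_one)
  then have "residue_size TYPE('a) \<noteq> 0"
    using finite_residue_field by (simp add: residue_size_def card_eq_0_iff)
  moreover have "1 / real (residue_size TYPE('a)) < 1"
    using ex_uniformizer [where 'a = 'a] by (auto simp: residue_size_def)
  ultimately show ?thesis
    by (cases "residue_size TYPE('a) = 1") auto
qed

text \<open>For nonzero arguments this is minus the normalized valuation; at 0 the value is
  immaterial.\<close>

definition log_absv :: "'a::nonarch_local_field \<Rightarrow> int" where
  "log_absv x = \<lfloor>log (real (residue_size TYPE('a))) (absv x)\<rfloor>"

text \<open>The floor loses nothing: otherwise rescaling by a power of \<open>p\<close> would give
  an element with absolute value strictly between 1/q and 1.\<close>

lemma absv_eq_powi_log_absv:
  assumes p: "uniformizer (p :: 'a::nonarch_local_field)" and x: "(x :: 'a) \<noteq> 0"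
  shows "absv x = real (residue_size TYPE('a)) powi log_absv x"
proof -
  define q where "q = real (residue_size TYPE('a))"
  define n where "n = log_absv x"
  have q: "q > 1"
    using residue_size_ge_2 [where 'a = 'a] by (simp add: q_def)
  have p_absv: "absv p = inverse q"
    using uniformizer_absv [OF p] by (simp add: q_def divide_inverse)
  have lower: "q powi n \<le> absv x" and upper: "absv x < q * q powi n"
  proof -
    have "n \<le> log q (absv x)" "log q (absv x) < n + 1"
      unfolding n_def log_absv_def q_def by linarith+
    then have "q powr n \<le> absv x" "absv x < q powr (n + 1)"
      using q x by (simp_all add: le_log_iff log_less_iff)
    then show "q powi n \<le> absv x" "absv x < q * q powi n"
      using q by (simp_all add: powr_real_of_int' powr_add mult.commute)
  qed
  show ?thesis
  proof (rule ccontr)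
    assume "absv x \<noteq> real (residue_size TYPE('a)) powi log_absv x"
    then have strict: "q powi n < absv x"
      using lower by (simp add: q_def n_def)
    define y where "y = inverse (x * p powi n)"
    have y: "absv y = inverse (absv x) * q powi n"
      by (simp add: y_def absv_times absv_inverse absv_power_int p_absv power_int_inverse)
    then have "absv y < 1"
      using strict x by (simp add: inverse_eq_divide)
    then have "absv y \<le> inverse q"
      using p p_absv by (metis uniformizer_def)
    then show False
      using upper x q by (simp add: y field_simps)
  qed
qed

lemma log_absv_eq_iff:
  assumes "uniformizer (p :: 'a::nonarch_local_field)"
  shows "x \<noteq> 0 \<and> log_absv (x :: 'a) = n \<longleftrightarrow> absv x = real (residue_size TYPE('a)) powi n"
proof (cases "x = 0")
  case True
  then show ?thesis
    using residue_size_ge_2 [where 'a = 'a] by simp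
next
  case False
  have "real (residue_size TYPE('a)) powi k \<noteq> real (residue_size TYPE('a)) powi l" if "k < l" for k l
    using power_int_strict_increasing [OF that] residue_size_ge_2 [where 'a = 'a]
    by (metis less_irrefl of_nat_1 of_nat_less_iff one_less_numeral_iff order_less_le_trans semiring_norm(76))
  then show ?thesis
    using absv_eq_powi_log_absv [OF assms False] False by (metis linorder_neqE)
qed

lemma log_absv_shell:
  assumes "uniformizer (p :: 'a::nonarch_local_field)"
  shows "{x. absv x = real (residue_size TYPE('a)) powi n} = (\<lambda>x. p powi (- n) * x) ` {x. absv x = 1}"
proof -
  define q where "q = real (residue_size TYPE('a))"
  have q: "q > 0"
    using residue_size_ge_2 [where 'a = 'a] by (simp add: q_def)
  have p_absv: "absv (p powi m) = inverse (q powi m)" for m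
    using uniformizer_absv [OF assms]
    by (simp add: absv_power_int q_def divide_inverse power_int_inverse)
  have p0: "p \<noteq> 0"
    using uniformizer_absv [OF assms] q by (auto simp: q_def)
  have "x \<in> (\<lambda>x. p powi (- n) * x) ` {x. absv x = 1}" if "absv x = q powi n" for x
  proof (rule image_eqI)
    show "x = p powi (- n) * (p powi n * x)"
      using p0 by (simp add: power_int_minus)
    show "p powi n * x \<in> {x. absv x = 1}"
      using q by (simp add: absv_times p_absv that)
  qed
  moreover have "absv (p powi (- n) * x) = q powi n" if "absv x = 1" for x
    using that by (simp add: absv_times p_absv [of "- n"]) (simp add: power_int_minus)
  ultimately show ?thesis
    unfolding q_def by blast
qed

text \<open>Every shell is a multiplicative translate of the units, so it has mass 1 by
  invariance.\<close>

lemma distr_log_absv: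
  assumes p: "uniformizer (p :: 'a::nonarch_local_field)" and M: "haar_units (M :: 'a measure)"
  shows "log_absv \<in> measurable M (count_space UNIV)"
    and "distr M (count_space UNIV) log_absv = count_space UNIV"
proof -
  have sets_M: "sets M = sets (restrict_space borel (UNIV - {0}))"
    and unit_vol: "emeasure M {x. absv x = 1} = 1"
    and inv: "\<And>a A. a \<noteq> 0 \<Longrightarrow> A \<in> sets M \<Longrightarrow> emeasure M ((\<lambda>x. a * x) ` A) = emeasure M A"
    using M by (simp_all add: haar_units_def)
  have space_M: "space M = UNIV - {0}"
    using sets_eq_imp_space_eq [OF sets_M] by (simp add: space_restrict_space)
  have sphere: "{x::'a. absv x = c} \<in> sets M" if "c \<noteq> 0" for c
  proof -
    have "{x::'a. absv x = c} = (UNIV - {0}) \<inter> sphere 0 c"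
      using that by (auto simp: absv_eq_dist_0 dist_commute [of 0])
    also have "\<dots> \<in> sets M"
      unfolding sets_M sets_restrict_space sphere_def
      by (intro imageI borel_closed closed_Collect_eq continuous_intros)
    finally show ?thesis .
  qed
  define q where "q = real (residue_size TYPE('a))"
  have q: "q > 0"
    using residue_size_ge_2 [where 'a = 'a] by (simp add: q_def)
  have shell: "log_absv -` {n} \<inter> space M = {x::'a. absv x = q powi n}" for n
  proof (intro set_eqI)
    show "x \<in> log_absv -` {n} \<inter> space M \<longleftrightarrow> x \<in> {x::'a. absv x = q powi n}" for x
      using log_absv_eq_iff [OF p, of x n] by (simp add: space_M q_def conj_commute)
  qed
  moreover have "{x::'a. absv x = q powi n} \<in> sets M" for n
    using q by (intro sphere) simp
  ultimately have "log_absv -` {n} \<inter> space M \<in> sets M" for n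
    by metis
  then show meas: "log_absv \<in> measurable M (count_space UNIV)"
    by (subst measurable_count_space_eq2_countable) auto
  have p0: "p \<noteq> 0"
    using uniformizer_absv [OF p] q by (auto simp: q_def)
  show "distr M (count_space UNIV) log_absv = count_space UNIV"
  proof (rule measure_eqI_countable)
    fix n :: int
    have "emeasure M (log_absv -` {n} \<inter> space M) = 1"
      unfolding shell q_def log_absv_shell [OF p]
      using inv [OF _ sphere, of "p powi (- n)" 1] p0 unit_vol by simp
    then show "emeasure (distr M (count_space UNIV) log_absv) {n} = emeasure (count_space UNIV) {n}"
      using meas by (simp add: emeasure_distr)
  qed auto
qed

lemma integral_count_space_int_eq_suminf:
  fixes h :: "int \<Rightarrow> complex"
  assumes neg: "\<And>n. n < 0 \<Longrightarrow> h n = 0" and sum: "summable (\<lambda>n. cmod (h (int n)))"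
  shows "integrable (count_space UNIV) h" and "(LINT n|count_space UNIV. h n) = suminf (\<lambda>n. h (int n))"
proof -
  have bij: "bij_betw int UNIV {0..}"
    by (rule bij_betwI [where g = nat]) auto
  have "Infinite_Set_Sum.abs_summable_on (\<lambda>n. h (int n)) UNIV"
    using sum by (simp add: abs_summable_on_nat_iff')
  then have "Infinite_Set_Sum.abs_summable_on h {0..}"
    by (simp add: abs_summable_on_reindex_bij_betw [OF bij])
  then have "Infinite_Set_Sum.abs_summable_on h UNIV"
    using neg by (subst abs_summable_on_cong_neutral [where B = "{0..}" and g = h]) auto
  then show "integrable (count_space UNIV) h"
    by (simp add: abs_summable_on_def)
  have "infsetsum h UNIV = infsetsum h {0..}"
    using neg by (intro infsetsum_cong_neutral) auto
  also have "\<dots> = infsetsum (\<lambda>n. h (int n)) UNIV"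
    by (simp add: infsetsum_reindex_bij_betw [OF bij])
  also have "\<dots> = suminf (\<lambda>n. h (int n))"
    using sum by (intro infsetsum_nat') (simp add: abs_summable_on_nat_iff')
  finally show "(LINT n|count_space UNIV. h n) = suminf (\<lambda>n. h (int n))"
    by (simp add: infsetsum_def)
qed

text \<open>The compact factor has total mass 1 and drops out; pushing the other factor forward
  along \<open>log_absv\<close> turns the integral into a series.\<close>

lemma quotient_integral_of_shell_function:
  fixes M :: "'a::nonarch_local_field measure" and K :: "('a^4^4) measure"
  assumes p: "uniformizer (p :: 'a)" and M: "haar_units M" and K: "haar_GSp4_integral K"
    and shell: "\<And>\<mu> k. \<mu> \<noteq> 0 \<Longrightarrow> k \<in> GSp4_integral \<Longrightarrow> quotient_integrand \<Phi> \<mu> k = h (log_absv \<mu>)"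
    and neg: "\<And>n. n < 0 \<Longrightarrow> h n = 0" and sum: "summable (\<lambda>n. cmod (h (int n)))"
  shows "quotient_integrable M K \<Phi>" and "quotient_integral M K \<Phi> = suminf (\<lambda>n. h (int n))"
proof -
  note distr = distr_log_absv [OF p M]
  note count = integral_count_space_int_eq_suminf [OF neg sum]
  have "sets M = sets (restrict_space borel (UNIV - {0}))"
    using M by (simp add: haar_units_def)
  from sets_eq_imp_space_eq [OF this] have space_M: "space M = UNIV - {0}"
    by (simp add: space_restrict_space)
  have "sets K = sets (restrict_space borel GSp4_integral)"
    using K by (simp add: haar_GSp4_integral_def)
  from sets_eq_imp_space_eq [OF this] have space_K: "space K = GSp4_integral"
    by (simp add: space_restrict_space)
  interpret K: prob_space K
    using K by (intro prob_spaceI) (simp add: space_K haar_GSp4_integral_def)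
  have [measurable]: "h \<in> borel_measurable (count_space UNIV)"
    by simp
  note distr(1) [measurable]
  have int_M: "integrable M (\<lambda>\<mu>. h (log_absv \<mu>))"
    using count(1) integrable_distr_eq [OF distr(1), of h] by (simp add: distr(2))
  \<comment> \<open>Projecting away the probability measure \<open>K\<close> pushes the product
    measure forward to \<open>M\<close>.\<close>
  have "integrable (M \<Otimes>\<^sub>M K) (\<lambda>x. h (log_absv (fst x)))"
    using int_M integrable_distr_eq [of fst "M \<Otimes>\<^sub>M K" M "\<lambda>\<mu>. h (log_absv \<mu>)"]
    by (simp add: K.distr_pair_fst)
  also have "?this \<longleftrightarrow> quotient_integrable M K \<Phi>"
    unfolding quotient_integrable_def
    by (intro Bochner_Integration.integrable_cong refl) (simp add: space_pair_measure space_M space_K shell case_prod_beta mem_Times_iff)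
  finally show "quotient_integrable M K \<Phi>" .
  have "quotient_integral M K \<Phi> = (LINT \<mu>|M. LINT k|K. h (log_absv \<mu>))"
    unfolding quotient_integral_def
    by (intro Bochner_Integration.integral_cong refl) (simp add: space_M space_K shell)
  also have "\<dots> = (LINT \<mu>|M. h (log_absv \<mu>))"
    by (simp add: K.prob_space)
  also have "\<dots> = (LINT n|count_space UNIV. h n)"
    using integral_distr [OF distr(1), of h] by (simp add: distr(2))
  finally show "quotient_integral M K \<Phi> = suminf (\<lambda>n. h (int n))"
    by (simp add: count(2))
qed

section \<open>The Shalika function on the torus\<close>

lemma prod_UNIV_4: "prod f (UNIV :: 4 set) = f 1 * f 2 * f 3 * f 4"
  unfolding UNIV_4 by (simp add: ac_simps)

lemma block_mult:
  fixes A B C D A' B' C' D' :: "'a::comm_ring_1^2^2"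
  shows "block A B C D ** block A' B' C' D' =
    block (A ** A' + B ** C') (A ** B' + B ** D') (C ** A' + D ** C') (C ** B' + D ** D')"
  by (simp add: vec_eq_iff forall_4 block_def vector_4 matrix_matrix_mult_def sum_UNIV_4 sum_2 add.assoc)

lemma mat_mult_nth: "(mat c ** A) $ i $ j = c * A $ i $ j" for A :: "'a::comm_ring_1^'n^'n"
  by (simp add: matrix_matrix_mult_def mat_def if_distrib [of "\<lambda>x. x * _"] cong: if_cong)

lemma mult_mat_nth: "(A ** mat c) $ i $ j = A $ i $ j * c" for A :: "'a::comm_ring_1^'n^'n"
  by (simp add: matrix_matrix_mult_def mat_def if_distrib [of "\<lambda>x. _ * x"] cong: if_cong)

lemma mat_mult_mat: "mat c ** mat d = (mat (c * d) :: 'a::comm_ring_1^'n^'n)"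
  by (simp add: vec_eq_iff mat_mult_nth) (simp add: mat_def)

text \<open>Since \<open>matrix_inv\<close> is a choice, uniqueness of two-sided inverses is what
  determines it.\<close>

lemma matrix_inv_eqI:
  fixes A B :: "'a::comm_ring_1^'n^'n"
  assumes "A ** B = mat 1" "B ** A = mat 1"
  shows "matrix_inv A = B"
proof -
  have "A ** matrix_inv A = mat 1 \<and> matrix_inv A ** A = mat 1"
    unfolding matrix_inv_def by (rule someI [of _ B]) (use assms in simp)
  then show ?thesis
    using assms by (metis matrix_mul_assoc matrix_mul_lid matrix_mul_rid)
qed

text \<open>The elements at which the Shalika function is normalized; modulo the centre,
  \<open>siegel_m\<close> is of this form with inverted parameter.\<close>

definition torus_elt :: "'a::field \<Rightarrow> 'a^4^4" where
  "torus_elt a = block (mat a) 0 0 (mat 1)"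

lemma torus_elt_mult: "torus_elt a ** torus_elt b = torus_elt (a * b)"
  by (simp add: torus_elt_def block_mult mat_mult_mat)

lemma det_torus_elt: "det (torus_elt a) = a ^ 2"
proof -
  have "det (torus_elt a) = (\<Prod>i\<in>UNIV. torus_elt a $ i $ i)"
  proof (rule det_diagonal)
    have "\<forall>i j. i \<noteq> j \<longrightarrow> torus_elt a $ i $ j = 0"
      by (simp add: forall_4 torus_elt_def block_def vector_4 mat_def)
    then show "torus_elt a $ i $ j = 0" if "i \<noteq> j" for i j
      using that by blast
  qed
  then show ?thesis
    by (simp add: prod_UNIV_4 torus_elt_def block_def vector_4 mat_def power2_eq_square)
qed

lemma torus_elt_GL4: "a \<noteq> 0 \<Longrightarrow> torus_elt a \<in> GL4"
  by (simp add: GL4_def invertible_det_nz det_torus_elt)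

lemma torus_elt_GL4_integral: "absv u = 1 \<Longrightarrow> torus_elt u \<in> GL4_integral"
  by (simp add: GL4_integral_def det_torus_elt absv_power)
    (simp add: forall_4 torus_elt_def block_def vector_4 mat_def)

text \<open>One entry suffices to give the upper right block any prescribed trace.\<close>

definition corner_unipotent :: "'a::field \<Rightarrow> 'a^4^4" where
  "corner_unipotent y = block (mat 1) (vector [vector [y, 0], vector [0, 0]]) 0 (mat 1)"

lemma det_corner_unipotent: "det (corner_unipotent y) = 1"
proof -
  have "det (corner_unipotent y) = (\<Prod>i\<in>UNIV. corner_unipotent y $ i $ i)"
  proof (rule det_upperdiagonal)
    \<comment> \<open>In the order on type 4, where 4 is least, only the nonzero entry at position
      (1,3) has to be seen to lie above the diagonal.\<close>
    have "(1 :: 4) < 3"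
      by (simp add: less_bit0_def bit0.Rep_1 bit0.Rep_numeral)
    then have "\<forall>i j. j < i \<longrightarrow> corner_unipotent y $ i $ j = 0"
      by (simp add: forall_4 corner_unipotent_def block_def vector_4 mat_def)
    then show "corner_unipotent y $ i $ j = 0" if "j < i" for i j
      using that by blast
  qed
  then show ?thesis
    by (simp add: prod_UNIV_4 corner_unipotent_def block_def vector_4 mat_def)
qed

lemma corner_unipotent_GL4: "corner_unipotent y \<in> GL4"
  by (simp add: GL4_def invertible_det_nz det_corner_unipotent)

lemma corner_unipotent_GL4_integral: "absv y \<le> 1 \<Longrightarrow> corner_unipotent y \<in> GL4_integral"
  by (simp add: GL4_integral_def det_corner_unipotent)
    (simp add: forall_4 corner_unipotent_def block_def vector_4 mat_def)

lemma torus_elt_corner_unipotent: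
  "torus_elt a ** corner_unipotent y = corner_unipotent (a * y) ** torus_elt a"
  by (simp add: torus_elt_def corner_unipotent_def block_mult)
    (simp add: vec_eq_iff forall_4 forall_2 block_def vector_4 mat_mult_nth mult_mat_nth)

lemma GL4_integral_subset_GL4: "GL4_integral \<subseteq> GL4"
  by (auto simp: GL4_integral_def GL4_def invertible_det_nz)

lemma smooth_rep_mult:
  "smooth_rep G sm \<pi> \<Longrightarrow> g \<in> G \<Longrightarrow> h \<in> G \<Longrightarrow> \<pi> (g ** h) v = \<pi> g (\<pi> h v)"
  by (simp add: smooth_rep_def)

lemma spherical_vector_mult:
  assumes "smooth_rep GL4 sm \<pi>" "spherical_vector GL4_integral \<pi> v" "g \<in> GL4" "k \<in> GL4_integral"
  shows "\<pi> (g ** k) v = \<pi> g v"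
proof -
  have "k \<in> GL4" "\<pi> k v = v"
    using assms(2,4) GL4_integral_subset_GL4 by (auto simp: spherical_vector_def)
  then show ?thesis
    using smooth_rep_mult [OF assms(1,3), of k v] by simp
qed

text \<open>For integral \<open>y\<close> the vector is fixed by \<open>corner_unipotent y\<close>, which the Shalika functional
  sees through \<open>torus_elt a\<close> as the character value \<open>\<psi> (a * y)\<close>.\<close>

lemma shalika_torus_eq_0:
  assumes rep: "smooth_rep GL4 sm \<pi>" and v: "spherical_vector GL4_integral \<pi> v"
    and Lambda: "shalika_functional \<psi> sm \<pi> \<Lambda>" and psi: "conductor_integers \<psi>"
    and a: "absv a > 1"
  shows "\<Lambda> (\<pi> (torus_elt a) v) = 0"
proof -
  \<comment> \<open>As \<open>a\<close> is not integral it lies outside the conductor, which yields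
    an integral \<open>y\<close> detected by the character.\<close>
  have "a \<notin> {x. \<forall>y. absv y \<le> 1 \<longrightarrow> \<psi> (x * y) = 1}"
    using a unfolding psi [unfolded conductor_integers_def] by simp
  then obtain y where y: "absv y \<le> 1" "\<psi> (a * y) \<noteq> 1"
    by blast
  have "a \<noteq> 0"
    using a by auto
  have shalika: "\<Lambda> (\<pi> (corner_unipotent b) w) = \<psi> b * \<Lambda> w" for b w
  proof -
    define X :: "'a^2^2" where "X = vector [vector [b, 0], vector [0, 0]]"
    have "invertible (mat 1 :: 'a^2^2)"
      by (simp add: invertible_det_nz)
    then have "\<Lambda> (\<pi> (block (mat 1) 0 0 (mat 1) ** block (mat 1) X 0 (mat 1)) w) = \<psi> (trace X) * \<Lambda> w"
      using Lambda unfolding shalika_functional_def by blast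
    then show ?thesis
      by (simp add: block_mult corner_unipotent_def X_def trace_def sum_2)
  qed
  have "\<Lambda> (\<pi> (torus_elt a) v) = \<Lambda> (\<pi> (torus_elt a ** corner_unipotent y) v)"
    using spherical_vector_mult [OF rep v torus_elt_GL4 corner_unipotent_GL4_integral] \<open>a \<noteq> 0\<close> y(1)
    by metis
  also have "\<dots> = \<psi> (a * y) * \<Lambda> (\<pi> (torus_elt a) v)"
    unfolding torus_elt_corner_unipotent
    by (simp add: smooth_rep_mult [OF rep corner_unipotent_GL4 torus_elt_GL4] \<open>a \<noteq> 0\<close> shalika)
  finally show ?thesis
    using y(2) by simp
qed

section \<open>The embedding \<open>iota\<close> and the Siegel torus\<close>

definition signature_elt :: "'a::field^4^4" where
  "signature_elt = diag4 1 1 (- 1) 1"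

lemma signature_elt_involution: "signature_elt ** signature_elt = mat 1"
  by (simp add: signature_elt_def vec_eq_iff forall_4 diag4_def vector_4 matrix_matrix_mult_def
      sum_UNIV_4 mat_def)

lemma iota_eq: "iota h = signature_elt ** h ** signature_elt"
  unfolding iota_def signature_elt_def [symmetric]
    matrix_inv_eqI [OF signature_elt_involution signature_elt_involution] ..

text \<open>Conjugation by a diagonal sign matrix changes entries only by signs.\<close>

lemma iota_GL4_integral:
  assumes "k \<in> GL4_integral"
  shows "iota k \<in> GL4_integral"
proof -
  have "det (iota k) = det k * det (signature_elt ** signature_elt)"
    unfolding iota_eq det_mul by (simp add: ac_simps)
  then have "det (iota k) = det k"
    by (simp add: signature_elt_involution)
  moreover have "\<forall>i j. absv (iota k $ i $ j) = absv (k $ i $ j)"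
    by (simp add: iota_eq signature_elt_def forall_4 diag4_def vector_4 matrix_matrix_mult_def sum_UNIV_4)
  ultimately show ?thesis
    using assms by (simp add: GL4_integral_def)
qed

lemma mat_GL4: "c \<noteq> 0 \<Longrightarrow> mat c \<in> GL4"
  by (auto simp: GL4_def invertible_def mat_mult_mat intro!: exI [of _ "mat (inverse c)"])

lemma siegel_m_eq: "\<mu> \<noteq> 0 \<Longrightarrow> siegel_m \<mu> = mat \<mu> ** torus_elt (inverse \<mu>)"
  by (simp add: siegel_m_def torus_elt_def vec_eq_iff mat_mult_nth)
    (simp add: forall_4 block_def vector_4 mat_def)

lemma signature_elt_siegel_m: "signature_elt ** siegel_m \<mu> = siegel_m \<mu> ** signature_elt"
  by (simp add: siegel_m_def signature_elt_def vec_eq_iff forall_4 diag4_def block_def vector_4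
      matrix_matrix_mult_def sum_UNIV_4 mat_def)

text \<open>Diagonal matrices commute, so \<open>iota\<close> affects only \<open>k\<close>; the
  spherical vector absorbs \<open>iota k\<close>, and the trivial central character removes the
  scalar.\<close>

lemma iota_siegel_m_mult:
  assumes rep: "smooth_rep GL4 sm \<pi>" "trivial_centre \<pi>" and v: "spherical_vector GL4_integral \<pi> v"
    and "\<mu> \<noteq> 0" "k \<in> GSp4_integral"
  shows "\<pi> (iota (siegel_m \<mu> ** k)) v = \<pi> (torus_elt (inverse \<mu>)) v"
proof -
  have "iota (siegel_m \<mu> ** k) = siegel_m \<mu> ** iota k"
    unfolding iota_eq matrix_mul_assoc signature_elt_siegel_m ..
  also have "\<dots> = mat \<mu> ** (torus_elt (inverse \<mu>) ** iota k)"
    using \<open>\<mu> \<noteq> 0\<close> by (simp add: siegel_m_eq matrix_mul_assoc)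
  finally have eq: "iota (siegel_m \<mu> ** k) = mat \<mu> ** (torus_elt (inverse \<mu>) ** iota k)" .
  have k: "iota k \<in> GL4_integral"
    using assms(5) by (intro iota_GL4_integral) (simp add: GSp4_integral_def)
  have t: "torus_elt (inverse \<mu>) \<in> GL4"
    using \<open>\<mu> \<noteq> 0\<close> by (intro torus_elt_GL4) simp
  have "torus_elt (inverse \<mu>) ** iota k \<in> GL4"
    using t k GL4_integral_subset_GL4 by (auto simp: GL4_def invertible_mult)
  moreover have "mat \<mu> \<in> GL4"
    using \<open>\<mu> \<noteq> 0\<close> by (rule mat_GL4)
  moreover have "\<pi> (mat \<mu>) = id"
    using rep(2) \<open>\<mu> \<noteq> 0\<close> by (simp add: trivial_centre_def)
  ultimately have "\<pi> (iota (siegel_m \<mu> ** k)) v = \<pi> (torus_elt (inverse \<mu>) ** iota k) v"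
    unfolding eq by (simp add: smooth_rep_mult [OF rep(1)])
  then show ?thesis
    using spherical_vector_mult [OF rep(1) v t k] by simp
qed

lemma siegel_m_parabolic:
  assumes "\<mu> \<noteq> 0"
  shows "siegel_m \<mu> \<in> siegel_parabolic" "siegel_delta (siegel_m \<mu>) = absv (inverse \<mu>) ^ 3"
proof -
  have inv1: "matrix_inv (mat 1) = (mat 1 :: 'a^2^2)"
    by (rule matrix_inv_eqI) simp_all
  have eq: "siegel_m \<mu> = siegel_element (mat 1) 0 \<mu>"
    unfolding siegel_m_def siegel_element_def inv1
    by (simp add: vec_eq_iff forall_4 forall_2 block_def vector_4 J2_def matrix_matrix_mult_def
        sum_2 mat_def transpose_def)
  have "invertible (siegel_m \<mu>)"
    using assms mat_GL4 [OF assms] torus_elt_GL4 [of "inverse \<mu>"]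
    by (simp add: siegel_m_eq invertible_mult GL4_def)
  moreover have "transpose (siegel_m \<mu>) ** J4 ** siegel_m \<mu> = mat \<mu> ** J4"
    by (simp add: siegel_m_def vec_eq_iff forall_4 block_def vector_4 J4_def J2_def
        matrix_matrix_mult_def sum_UNIV_4 mat_def transpose_def)
  ultimately have GSp4: "siegel_m \<mu> \<in> GSp4"
    using assms by (auto simp: GSp4_def)
  have one: "invertible (mat 1 :: 'a^2^2)"
    by (simp add: invertible_det_nz)
  show "siegel_m \<mu> \<in> siegel_parabolic"
    using GSp4 assms one eq unfolding siegel_parabolic_def by blast
  show "siegel_delta (siegel_m \<mu>) = absv (inverse \<mu>) ^ 3"
    using siegel_delta_siegel_element(2) [OF one] GSp4 by (simp add: eq divide_inverse)
qed

section \<open>The zeta integral\<close>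

text \<open>The base is a positive real, so its principal logarithm is the real one and exponents
  multiply without branch corrections.\<close>

lemma powr_siegel_delta:
  fixes s :: complex
  assumes "q > 0"
  shows "of_real ((1 / real q ^ m) ^ 3) powr ((s + 1) / 3) = (of_nat q powr (- s) / of_nat q) ^ m"
proof -
  define L where "L = ln (real q)"
  have q_exp: "real q = exp L"
    using assms by (simp add: L_def)
  have qc: "(of_nat q :: complex) = exp (of_real L)"
    using q_exp by (metis exp_of_real of_real_of_nat_eq)
  have "(1 / real q ^ m) ^ 3 = exp (- (3 * real m * L))"
    by (simp add: q_exp exp_minus field_simps flip: exp_of_nat_mult)
  then have "of_real ((1 / real q ^ m) ^ 3) powr ((s + 1) / 3) = exp ((s + 1) / 3 * of_real (- (3 * real m * L)))"
    by (simp add: powr_def Ln_of_real)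
  also have "\<dots> = exp (of_nat m * (- s * of_real L - of_real L))"
    by (rule arg_cong [of _ _ exp]) (simp add: field_simps)
  also have "\<dots> = (exp (- s * of_real L - of_real L)) ^ m"
    by (rule exp_of_nat_mult)
  also have "exp (- s * of_real L - of_real L) = of_nat q powr (- s) / of_nat q"
    using assms by (simp add: powr_def exp_diff qc)
  finally show ?thesis .
qed

theorem theorem6p3:
  fixes varpi :: "'a::nonarch_local_field"
    and \<psi> chi1 chi2 :: "'a \<Rightarrow> complex"
    and smV :: "complex \<Rightarrow> 'v::ab_group_add \<Rightarrow> 'v" and \<pi> :: "'a^4^4 \<Rightarrow> 'v \<Rightarrow> 'v"
    and smW :: "complex \<Rightarrow> 'w::ab_group_add \<Rightarrow> 'w" and \<sigma> :: "'a^4^4 \<Rightarrow> 'w \<Rightarrow> 'w"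
    and \<phi>0 :: 'v and \<Lambda> :: "'v \<Rightarrow> complex"
    and s :: complex and f :: "'a^4^4 \<Rightarrow> complex"
    and dmu :: "'a measure" and dk :: "('a^4^4) measure"
    and q :: nat and gchi :: "complex^4^4"
  assumes uniformizer: "uniformizer varpi"
    and q: "q = residue_size TYPE('a)"
    and psi_char: "additive_character \<psi>" "\<exists>x. \<psi> x \<noteq> 1" "conductor_integers \<psi>"
    and Pi: "smooth_rep GL4 smV \<pi>" "trivial_centre \<pi>" "irreducible_rep GL4 smV \<pi>"
      "generic_rep \<psi> smV \<pi>"
    and characters: "unramified_character chi1" "unramified_character chi2"
    and Pi_induced: "isomorphic_to_induced GL4 smV \<pi>
      (I_GL4 chi1 chi2 (\<lambda>x. inverse (chi2 x)) (\<lambda>x. inverse (chi1 x)))"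
    and gchi: "gchi = satake_matrix (chi1 varpi) (chi2 varpi)"
    and sigma: "unramified_PGSp4_with_satake varpi smW \<sigma> gchi"
    and phi0: "spherical_vector GL4_integral \<pi> \<phi>0"
    and Lambda: "shalika_functional \<psi> smV \<pi> \<Lambda>"
    and Lambda_normalized: "\<And>n::nat.
      \<Lambda> (\<pi> (block (mat (varpi ^ n)) 0 0 (mat 1)) \<phi>0) =
        inverse (of_nat q) ^ (2 * n) / (1 + inverse (of_nat q))
          * laurent_at (weyl_quotient (shalika_numerator q n)) gchi"
    and f_s: "f \<in> Ind_siegel s"
      "\<And>k. k \<in> GSp4_integral \<Longrightarrow> f k = zeta_F TYPE('a) (s + 1) * zeta_F TYPE('a) (2 * s)"
    and measures: "haar_units dmu" "haar_GSp4_integral dk"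
    and convergence: "\<And>l. l \<in> set (std_eigenvalues gchi) \<Longrightarrow> cmod l < real q powr (Re s)"
  shows "quotient_integrable dmu dk (\<lambda>h. f h * \<Lambda> (\<pi> (iota h) \<phi>0)) \<and>
    quotient_integral dmu dk (\<lambda>h. f h * \<Lambda> (\<pi> (iota h) \<phi>0)) = L_std q gchi s"
proof -
  define t1 t2 x where "t1 = chi1 varpi" and "t2 = chi2 varpi" and "x = of_nat q powr (- s)"
  define c where "c n = laurent_at (weyl_char n) gchi" for n
  define Z where "Z = zeta_F TYPE('a) (s + 1) * zeta_F TYPE('a) (2 * s)"
  define \<Phi> where "\<Phi> h = f h * \<Lambda> (\<pi> (iota h) \<phi>0)" for h
  \<comment> \<open>The value of the integrand on the shell of radius q^n; with the index offset 3,
    the two \<open>c\<close> terms are the characters of highest weights (n, n) and (n - 1, n -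
    1).\<close>
  define h where "h n = (if n < 0 then 0 else Z * (c (nat n + 3) - c (nat n + 2) / of_nat q) * x ^ nat n)" for n
  have q2: "q \<ge> 2"
    unfolding q by (rule residue_size_ge_2)
  then have q0: "(of_nat q :: complex) \<noteq> 0" "real q > 0"
    by simp_all
  have varpi0: "varpi \<noteq> 0"
    using uniformizer_absv [OF uniformizer] q2 q by auto
  have varpi_absv: "absv varpi = inverse (real q)"
    using uniformizer_absv [OF uniformizer] by (simp add: q divide_inverse)
  have t: "t1 \<noteq> 0" "t2 \<noteq> 0"
    using characters varpi0 by (simp_all add: t1_def t2_def unramified_character_def)
  have gchi': "gchi = satake_matrix t1 t2"
    by (simp add: gchi t1_def t2_def)
  have eigenvalues: "std_eigenvalues gchi = [t1 * t2, t1 * inverse t2, 1, inverse t1 * t2, inverse t1 * inverse t2]"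
    by (simp add: std_eigenvalues_def gchi' satake_matrix_def diag4_def vector_4)
  have norm_x: "cmod x = real q powr (- Re s)"
    using q2 by (simp add: x_def norm_powr_real_powr)
  have small: "cmod (l * x) < 1" if "l \<in> set (std_eigenvalues gchi)" for l
  proof -
    have "cmod l * real q powr (- Re s) < real q powr (Re s) * real q powr (- Re s)"
      using convergence [OF that] q2 by (intro mult_strict_right_mono) simp_all
    also have "\<dots> = 1"
      using q2 by (simp flip: powr_add)
    finally show ?thesis
      by (simp add: norm_mult norm_x)
  qed
  note series = weyl_char_series [OF t, of x, folded gchi', folded c_def]
  \<comment> \<open>The eigenvalue 1 contributes \<open>cmod x < 1\<close>, which controls the zeta
    factors.\<close>
  have small': "cmod (t1 * t2 * x) < 1" "cmod (inverse t1 * inverse t2 * x) < 1"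
    "cmod (t1 * inverse t2 * x) < 1" "cmod (inverse t1 * t2 * x) < 1" "cmod x < 1"
    using small eigenvalues by force+
  define S where "S = suminf (\<lambda>n. c (n + 3) * x ^ n)"
  note S = series [OF small'(1-4), folded S_def]
  have weight: "quotient_integrand \<Phi> \<mu> k = h (log_absv \<mu>)" if "\<mu> \<noteq> 0" "k \<in> GSp4_integral" for \<mu> k
  proof -
    define n where "n = log_absv \<mu>"
    have absv_mu: "absv \<mu> = real q powi n"
      unfolding n_def q by (rule absv_eq_powi_log_absv [OF uniformizer that(1)])
    have k: "k \<in> GSp4"
      using that by (simp add: GSp4_integral_def)
    have "f (siegel_m \<mu> ** k) = of_real (siegel_delta (siegel_m \<mu>)) powr ((s + 1) / 3) * f k"
      using f_s(1) siegel_m_parabolic(1) [OF that(1)] k by (simp add: Ind_siegel_def induced_def)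
    then have f_eq: "f (siegel_m \<mu> ** k) = of_real (absv (inverse \<mu>) ^ 3) powr ((s + 1) / 3) * Z"
      using f_s(2) that siegel_m_parabolic(2) [OF that(1)] by (simp add: Z_def)
    have \<Lambda>_eq: "\<pi> (iota (siegel_m \<mu> ** k)) \<phi>0 = \<pi> (torus_elt (inverse \<mu>)) \<phi>0"
      by (rule iota_siegel_m_mult [OF Pi(1,2) phi0 that])
    show ?thesis
    proof (cases "n < 0")
      case True
      \<comment> \<open>Small \<mu> means a large torus parameter, where the Shalika function
        vanishes.\<close>
      have "absv (inverse \<mu>) > 1"
        using power_int_strict_increasing [of 0 "- n" "real q"] True q2
        by (simp add: absv_inverse absv_mu power_int_minus)
      then have "\<Lambda> (\<pi> (torus_elt (inverse \<mu>)) \<phi>0) = 0"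
        by (rule shalika_torus_eq_0 [OF Pi(1) phi0 Lambda psi_char(3)])
      then show ?thesis
        using True by (simp add: quotient_integrand_def \<Phi>_def \<Lambda>_eq h_def n_def [symmetric])
    next
      case False
      then obtain m where m: "n = int m"
        using nonneg_int_cases by (metis not_less)
      have absv_inv: "absv (inverse \<mu>) = 1 / real q ^ m"
        by (simp add: absv_inverse absv_mu m divide_inverse)
      \<comment> \<open>The unit part of \<open>inverse \<mu>\<close>; its torus element fixes the
        spherical vector, leaving a power of \<open>varpi\<close>, where the normalization
        applies.\<close>
      define \<epsilon> where "\<epsilon> = inverse \<mu> / varpi ^ m"
      have eps: "varpi ^ m * \<epsilon> = inverse \<mu>"
        using varpi0 by (simp add: \<epsilon>_def)
      from arg_cong [OF this, of absv] have "inverse (real q) ^ m * absv \<epsilon> = inverse (real q) ^ m"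
        unfolding absv_times absv_power varpi_absv absv_inv by (simp only: power_one_over inverse_eq_divide)
      then have unit: "absv \<epsilon> = 1"
        using q0(2) by (metis inverse_zero_imp_zero less_irrefl mult_cancel_left2 power_eq_0_iff mult.right_neutral)
      have "torus_elt (inverse \<mu>) = torus_elt (varpi ^ m) ** torus_elt \<epsilon>"
        by (simp only: torus_elt_mult eps)
      then have "\<pi> (torus_elt (inverse \<mu>)) \<phi>0 = \<pi> (torus_elt (varpi ^ m)) \<phi>0"
        using spherical_vector_mult [OF Pi(1) phi0 torus_elt_GL4 torus_elt_GL4_integral [OF unit]] varpi0
        by simp
      moreover have "\<Lambda> (\<pi> (torus_elt (varpi ^ m)) \<phi>0) =
          (c (m + 3) - c (m + 2) / of_nat q) / of_nat q ^ (2 * m)"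
      proof -
        \<comment> \<open>This lets the factor 1 + 1/q of the alternating sum cancel the one in the
          normalization of \<Lambda>.\<close>
        have nz: "1 + inverse (of_nat q) \<noteq> (0 :: complex)"
        proof -
          have "1 + inverse (of_nat q) = (of_real (1 + inverse (real q)) :: complex)"
            by simp
          moreover have "1 + inverse (real q) \<noteq> 0"
            using q0(2) by (smt (verit) inverse_positive_iff_positive)
          ultimately show ?thesis
            by (metis of_real_eq_0_iff)
        qed
        have "laurent_at (weyl_quotient (shalika_numerator q m)) gchi =
            (1 + inverse (of_nat q)) * (c (m + 3) - c (m + 2) / of_nat q)"
          using q2 t
          by (simp add: weyl_quotient_shalika_numerator laurent_at_mult laurent_at_diff laurent_at_const
              c_def gchi' satake_matrix_def diag4_def vector_4 divide_inverse)
        then show ?thesis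
          using Lambda_normalized [of m] nz by (simp add: torus_elt_def power_inverse divide_inverse)
      qed
      moreover have "inverse (absv (inverse \<mu>) ^ 3) = real q ^ (3 * m)"
        by (simp add: absv_inv power_one_over power_mult [symmetric] mult.commute)
      \<comment> \<open>The powers of q balance: 3m from the inverse modulus, -m from
        \<open>f\<close> and -2m from the Shalika function.\<close>
      ultimately have "quotient_integrand \<Phi> \<mu> k = of_nat q ^ (3 * m) * ((x / of_nat q) ^ m * Z *
          ((c (m + 3) - c (m + 2) / of_nat q) / of_nat q ^ (2 * m)))"
        using q2 powr_siegel_delta [of q m s] unfolding quotient_integrand_def \<Phi>_def f_eq \<Lambda>_eq
          siegel_m_parabolic(2) [OF that(1)]
        by (simp add: absv_inv x_def)
      also have "\<dots> = Z * (c (m + 3) - c (m + 2) / of_nat q) * x ^ m"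
      proof -
        have "(of_nat q :: complex) ^ (3 * m) = of_nat q ^ m * of_nat q ^ (2 * m)"
          by (simp flip: power_add)
        then show ?thesis
          using q0 by (simp add: power_divide)
      qed
      finally show ?thesis
        by (simp add: h_def n_def [symmetric] m)
    qed
  qed
  have S_sums: "(\<lambda>n. c (n + 3) * x ^ n) sums S"
    unfolding S_def by (rule summable_sums [OF summable_norm_cancel [OF S(2)]])
  have summable_c2: "summable (\<lambda>n. cmod (c (n + 2) * x ^ n))"
  proof -
    have "summable (\<lambda>n. cmod x * cmod (c (n + 3) * x ^ n))"
      by (rule summable_mult [OF S(2)])
    then have "summable (\<lambda>n. cmod (c (Suc n + 2) * x ^ Suc n))"
      by (simp add: norm_mult norm_power eval_nat_numeral ac_simps)
    then show ?thesis
      by (rule iffD1 [OF summable_Suc_iff])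
  qed
  \<comment> \<open>Since \<open>c 2 = 0\<close>, this series has no constant term and is
    \<open>x\<close> times the previous one.\<close>
  have c2_sums: "(\<lambda>n. c (n + 2) * x ^ n) sums (x * S)"
  proof -
    have "(\<lambda>n. x * (c (n + 3) * x ^ n)) sums (x * S)"
      by (intro sums_mult S_sums)
    then have "(\<lambda>n. c (Suc n + 2) * x ^ Suc n) sums (x * S)"
      by (simp add: eval_nat_numeral ac_simps)
    from sums_Suc [OF this] show ?thesis
      using S(1) by (simp del: add_2_eq_Suc add_2_eq_Suc')
  qed
  have h_eq: "h (int n) = Z * (c (n + 3) * x ^ n) - Z / of_nat q * (c (n + 2) * x ^ n)" for n
    by (simp add: h_def algebra_simps)
  have h_summable: "summable (\<lambda>n. cmod (h (int n)))"
  proof (rule summable_comparison_test')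
    show "summable (\<lambda>n. cmod Z * cmod (c (n + 3) * x ^ n) + cmod (Z / of_nat q) * cmod (c (n + 2) * x ^ n))"
      by (intro summable_add summable_mult S(2) summable_c2)
    show "norm (cmod (h (int n))) \<le>
        cmod Z * cmod (c (n + 3) * x ^ n) + cmod (Z / of_nat q) * cmod (c (n + 2) * x ^ n)" for n
      unfolding h_eq using norm_triangle_ineq4 [of "Z * (c (n + 3) * x ^ n)" "Z / of_nat q * (c (n + 2) * x ^ n)"]
      by (simp add: norm_mult norm_divide)
  qed
  note integral = quotient_integral_of_shell_function [OF uniformizer measures weight _ h_summable]
  have "(\<lambda>n. h (int n)) sums (Z * S - Z / of_nat q * (x * S))"
    unfolding h_eq by (intro sums_diff sums_mult S_sums c2_sums)
  \<comment> \<open>The difference of the two series contributes the factor that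
    \<open>zeta_F\<close> at \<open>s + 1\<close> inverts.\<close>
  then have h_sum: "suminf (\<lambda>n. h (int n)) = Z * (1 - x / of_nat q) * S"
    by (simp add: sums_iff algebra_simps)
  have Z_eq: "Z = inverse (1 - x / of_nat q) * inverse (1 - x ^ 2)"
  proof -
    have "of_nat q powr (- (s + 1)) = x / of_nat q"
      using q0 by (simp add: x_def powr_diff)
    moreover have "of_nat q powr (- (2 * s)) = x ^ 2"
      using q0 by (simp add: x_def powr_def mult.assoc flip: exp_double)
    ultimately show ?thesis
      by (simp add: Z_def zeta_F_def flip: q)
  qed
  have nz: "1 - y \<noteq> 0" if "cmod y < 1" for y :: complex
    using that by auto
  have nz1: "1 - x / of_nat q \<noteq> 0"
  proof (rule nz)
    have "cmod x / real q \<le> cmod x"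
      using q2 by (simp add: divide_le_eq mult_le_cancel_left1)
    then show "cmod (x / of_nat q) < 1"
      using small'(5) by (simp add: norm_divide)
  qed
  \<comment> \<open>The numerator \<open>1 + x\<close> must cancel against
    \<open>1 - x ^ 2\<close>.\<close>
  have nz2: "1 - x \<noteq> 0" "1 + x \<noteq> 0"
    using nz [of x] nz [of "- x"] small'(5) by simp_all
  have "suminf (\<lambda>n. h (int n)) = inverse (1 - x ^ 2) * S"
    using nz1 by (simp add: h_sum Z_eq)
  also have "\<dots> = L_std q gchi s"
  proof -
    \<comment> \<open>The Euler factors of the four nontrivial weights; the one of the eigenvalue 1
      is the \<open>1 - x\<close> left over from \<open>1 - x ^ 2\<close>.\<close>
    define P where "P = (1 - t1 * t2 * x) * (1 - inverse t1 * inverse t2 * x) *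
      (1 - t1 * inverse t2 * x) * (1 - inverse t1 * t2 * x)"
    have P: "P \<noteq> 0"
      unfolding P_def using nz small'(1-4) by simp
    have "L_std q gchi s = inverse ((1 - x) * P)"
      by (simp add: L_std_def eigenvalues P_def inverse_mult_distrib x_def [symmetric] ac_simps)
    moreover have "P * S = 1 + x"
      unfolding P_def by (rule S(3))
    then have "S = (1 + x) / P"
      using P by (simp add: field_simps)
    moreover have "1 - x ^ 2 = (1 + x) * (1 - x)"
      by (simp add: algebra_simps power2_eq_square)
    moreover have "inverse ((1 + x) * (1 - x)) * ((1 + x) / P) = inverse ((1 - x) * P)"
      using nz2(2) by (simp add: inverse_mult_distrib divide_inverse)
    ultimately show ?thesis
      by (simp only:)
  qed
  finally have "suminf (\<lambda>n. h (int n)) = L_std q gchi s" .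
  moreover have "h n = 0" if "n < 0" for n
    using that by (simp add: h_def)
  ultimately have "quotient_integrable dmu dk \<Phi> \<and> quotient_integral dmu dk \<Phi> = L_std q gchi s"
    using integral by simp
  then show ?thesis
    unfolding \<Phi>_def .
qed

end
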